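(* Let $\mu$ and $\nu$ be partitions and let $\boldsymbol{s}=(s_{ij})\in T(\mu,\mathbb{C})$ and $\boldsymbol{t}=(t_{kl})\in T(\nu,\mathbb{C})$. Suppose that the real parts of all $s_{ij}$ and all $t_{kl}$ are greater than $1$. For each skew partition $\lambda/\mu$ such that $|\lambda/\mu|=|\nu|$, fix a filling $\boldsymbol{u}_\lambda(\boldsymbol{s},\boldsymbol{t})$ of $D(\lambda)$ with $\{s_{ij}\mid(i,j)\in D(\mu)\}\cup\{t_{kl}\mid(k,l)\in D(\nu)\}$ (as indeterminates, each being used exactly once). Then $$\sum_{sym}\zeta_\mu(\boldsymbol{s})\,\zeta_\nu(\boldsymbol{t})=\sum_{sym}\sum_{\lambda}c_{\mu\nu}^{\lambda}\,\zeta_\lambda(\boldsymbol{u}_\lambda(\boldsymbol{s},\boldsymbol{t})),$$ where $\lambda$ runs over the partitions such that $\lambda/\mu$ is a skew partition with $|\lambda/\mu|=|\nu|$, and $\sum_{sym}$ means the summation over all permutations of $\{s_{ij}\mid(i,j)\in D(\mu)\}\cup\{t_{kl}\mid(k,l)\in D(\nu)\}$ as indeterminates.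
   Context: Partitions and tableaux. A partition $\lambda=(\lambda_1\ge\lambda_2\ge\cdots\ge 0)$ has length $l(\lambda)$ (number of nonzero parts) and weight $|\lambda|=\sum_i\lambda_i$; its Young diagram is $D(\lambda)=\{(i,j)\in\mathbb{Z}^2\mid 1\le i\le l(\lambda),\ 1\le j\le\lambda_i\}$ ($i$ is the row, counted from the top; $j$ is the column). For a set $X$, $T(\lambda,X)$ is the set of all fillings $(t_{ij})_{(i,j)\in D(\lambda)}$ of $D(\lambda)$ with elements of $X$. If $\mu_i\le\lambda_i$ for all $i$, the skew partition $\lambda/\mu$ is the set of boxes of $D(\lambda)$ not in $D(\mu)$, and $|\lambda/\mu|=|\lambda|-|\mu|$. A semistandard tableau of shape $\lambda/\mu$ is a filling of $\lambda/\mu$ with positive integers with rows weakly increasing and columns strictly increasing; $SSYT(\lambda)$ is the set of semistandard tableaux of (non-skew) shape $\lambda$. Schur multiple zeta function. For $\boldsymbol{s}=(s_{ij})\in T(\lambda,\mathbb{C})$, $$\zeta_\lambda(\boldsymbol{s})=\sum_{M\in SSYT(\lambda)}\frac{1}{M^{\boldsymbol{s}}},\qquad M^{\boldsymbol{s}}=\prod_{(i,j)\in D(\lambda)}m_{ij}^{s_{ij}}\quad\text{for } M=(m_{ij}).$$ Littlewood-Richardson coefficients. The reading word of a skew semistandard tableau is the word obtained by concatenating its rows (each read left to right), starting from the bottom row and going up. A word $u_1\cdots u_k$ is a Yamanouchi word if for all $i\ge1$ and all $1\le j\le k$, the number of $i$'s among $u_j,\ldots,u_k$ (with multiplicity) is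 greater than or equal to the number of $(i+1)$'s. $c_{\mu\nu}^{\lambda}$ is the number of skew semistandard tableaux $T$ of shape $\lambda/\mu$ whose reading word is a Yamanouchi word and in which the entry $j$ appears exactly $\nu_j$ times for each $j\in\mathbb{Z}_{>0}$. Symmetrization. $\sum_{sym}$ treats the variables in the given set as distinct indeterminates (even if some of their complex values coincide): one sums, over all permutations $\sigma$ of this set, the expression obtained by simultaneously replacing each variable $x$ by $\sigma(x)$ throughout the expression. *)

theory Defs
  imports "HOL-Analysis.Analysis" "HOL-Combinatorics.Permutations"
begin

text \<open>
  A partition is its sequence of parts, indexed from 1. The unused index 0 is set to 0, so that
  distinct functions are distinct partitions.
\<close>

definition is_partition :: "(nat \<Rightarrow> nat) \<Rightarrow> bool" where
  "is_partition lam \<longleftrightarrow>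
     lam 0 = 0 \<and> (\<forall>i\<ge>1. lam (Suc i) \<le> lam i) \<and> finite {i. lam i \<noteq> 0}"

definition plength :: "(nat \<Rightarrow> nat) \<Rightarrow> nat" where
  "plength lam = card {i. lam i \<noteq> 0}"

definition weight :: "(nat \<Rightarrow> nat) \<Rightarrow> nat" where
  "weight lam = (\<Sum>i | lam i \<noteq> 0. lam i)"

definition diagram :: "(nat \<Rightarrow> nat) \<Rightarrow> (nat \<times> nat) set" where
  "diagram lam = {(i, j). 1 \<le> i \<and> i \<le> plength lam \<and> 1 \<le> j \<and> j \<le> lam i}"

definition is_skew :: "(nat \<Rightarrow> nat) \<Rightarrow> (nat \<Rightarrow> nat) \<Rightarrow> bool" where
  "is_skew lam \<mu> \<longleftrightarrow> is_partition lam \<and> is_partition \<mu> \<and> (\<forall>i. \<mu> i \<le> lam i)"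

definition skew_diagram :: "(nat \<Rightarrow> nat) \<Rightarrow> (nat \<Rightarrow> nat) \<Rightarrow> (nat \<times> nat) set" where
  "skew_diagram lam \<mu> = diagram lam - diagram \<mu>"

definition skew_weight :: "(nat \<Rightarrow> nat) \<Rightarrow> (nat \<Rightarrow> nat) \<Rightarrow> nat" where
  "skew_weight lam \<mu> = weight lam - weight \<mu>"

text \<open>
  Fillings are extensional functions, so that they are determined by their values on the boxes.
\<close>

definition fillings :: "(nat \<Rightarrow> nat) \<Rightarrow> 'a set \<Rightarrow> (nat \<times> nat \<Rightarrow> 'a) set" where
  "fillings lam X = diagram lam \<rightarrow>\<^sub>E X"

definition semistandard :: "(nat \<times> nat) set \<Rightarrow> (nat \<times> nat \<Rightarrow> nat) \<Rightarrow> bool" where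
  "semistandard D T \<longleftrightarrow>
     (\<forall>i j j'. (i, j) \<in> D \<and> (i, j') \<in> D \<and> j < j' \<longrightarrow> T (i, j) \<le> T (i, j')) \<and>
     (\<forall>i i' j. (i, j) \<in> D \<and> (i', j) \<in> D \<and> i < i' \<longrightarrow> T (i, j) < T (i', j))"

definition SSYT :: "(nat \<Rightarrow> nat) \<Rightarrow> (nat \<times> nat \<Rightarrow> nat) set" where
  "SSYT lam = {M \<in> fillings lam {1..}. semistandard (diagram lam) M}"

definition skew_SSYT :: "(nat \<Rightarrow> nat) \<Rightarrow> (nat \<Rightarrow> nat) \<Rightarrow> (nat \<times> nat \<Rightarrow> nat) set" where
  "skew_SSYT lam \<mu> =
     {T \<in> skew_diagram lam \<mu> \<rightarrow>\<^sub>E {1..}. semistandard (skew_diagram lam \<mu>) T}"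

definition tableau_power ::
  "(nat \<Rightarrow> nat) \<Rightarrow> (nat \<times> nat \<Rightarrow> nat) \<Rightarrow> (nat \<times> nat \<Rightarrow> complex) \<Rightarrow> complex" where
  "tableau_power lam M s = (\<Prod>p\<in>diagram lam. of_nat (M p) powr s p)"

definition schur_zeta :: "(nat \<Rightarrow> nat) \<Rightarrow> (nat \<times> nat \<Rightarrow> complex) \<Rightarrow> complex" where
  "schur_zeta lam s = (\<Sum>\<^sub>\<infinity>M\<in>SSYT lam. 1 / tableau_power lam M s)"

text \<open>
  Row \<open>i\<close> of \<open>lam/\<mu>\<close> occupies the columns \<open>\<mu> i + 1, \<dots>, lam i\<close>; rows are numbered from the top,
  hence the reversal.
\<close>

definition reading_word ::
  "(nat \<Rightarrow> nat) \<Rightarrow> (nat \<Rightarrow> nat) \<Rightarrow> (nat \<times> nat \<Rightarrow> nat) \<Rightarrow> nat list" where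
  "reading_word lam \<mu> T =
     concat (map (\<lambda>i. map (\<lambda>j. T (i, j)) [Suc (\<mu> i)..<Suc (lam i)]) (rev [1..<Suc (plength lam)]))"

definition yamanouchi :: "nat list \<Rightarrow> bool" where
  "yamanouchi w \<longleftrightarrow>
     (\<forall>i\<ge>1. \<forall>j<length w. count_list (drop j w) i \<ge> count_list (drop j w) (Suc i))"

definition LR_coeff :: "(nat \<Rightarrow> nat) \<Rightarrow> (nat \<Rightarrow> nat) \<Rightarrow> (nat \<Rightarrow> nat) \<Rightarrow> nat" where
  "LR_coeff \<mu> \<nu> lam =
     card {T \<in> skew_SSYT lam \<mu>. yamanouchi (reading_word lam \<mu> T) \<and>
             (\<forall>j\<ge>1. card {p \<in> skew_diagram lam \<mu>. T p = j} = \<nu> j)}"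

definition LR_shapes :: "(nat \<Rightarrow> nat) \<Rightarrow> (nat \<Rightarrow> nat) \<Rightarrow> (nat \<Rightarrow> nat) set" where
  "LR_shapes \<mu> \<nu> = {lam. is_skew lam \<mu> \<and> skew_weight lam \<mu> = weight \<nu>}"

text \<open>
  The variables \<open>s\<^sub>i\<^sub>j\<close> and \<open>t\<^sub>k\<^sub>l\<close> as indeterminates: one label per box, so they are distinct
  whatever values the variables take.
\<close>

definition indets ::
  "(nat \<Rightarrow> nat) \<Rightarrow> (nat \<Rightarrow> nat) \<Rightarrow> ((nat \<times> nat) + (nat \<times> nat)) set" where
  "indets \<mu> \<nu> = diagram \<mu> <+> diagram \<nu>"

text \<open>
  An expression \<open>F\<close> in the indeterminates \<open>V\<close> is a function of the assignment \<open>x\<close> of values to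
  them; replacing every indeterminate \<open>v\<close> by \<open>\<sigma> v\<close> in \<open>F\<close> and then evaluating at \<open>x\<close> gives
  \<open>F (x \<circ> \<sigma>)\<close>.
\<close>

definition sym_sum :: "'v set \<Rightarrow> (('v \<Rightarrow> complex) \<Rightarrow> complex) \<Rightarrow> ('v \<Rightarrow> complex) \<Rightarrow> complex" where
  "sym_sum V F x = (\<Sum>\<sigma> | \<sigma> permutes V. F (x \<circ> \<sigma>))"

end

theory Submission
  imports Defs "HOL-Library.Poly_Mapping"
begin

text \<open>
  Symmetrising \<open>1 / M\<^sup>s\<close> over all variables gives a number that depends only on the multiset of
  entries of \<open>M\<close>. Hence the theorem follows from a content-preserving bijection between pairs of
  tableaux of shapes \<open>\<mu>\<close>, \<open>\<nu>\<close> and tableaux of shape \<open>\<lambda>\<close> taken \<open>c\<^sup>\<lambda>\<^sub>\<mu>\<^sub>\<nu>\<close> times, that is, from the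
  Littlewood-Richardson rule for Schur polynomials in \<open>N\<close> variables. The rule is proved following
  Stembridge: as the Schur polynomial of \<open>\<nu>\<close> is symmetric, its product with the alternant of
  \<open>\<mu> + \<delta>\<close> is the sum of the alternants of \<open>\<mu> + \<delta> + weight T\<close> over all tableaux \<open>T\<close> of shape \<open>\<nu>\<close>. A
  Bender-Knuth involution on the part of \<open>T\<close> not yet read when its word first leaves the dominant
  chamber cancels all terms but those with \<open>\<mu>\<close>-dominant word. For \<open>\<mu> = 0\<close> this gives the
  bialternant formula, so that the alternant of \<open>\<delta>\<close> can be cancelled. Tableaux are encoded as
  Gelfand-Tsetlin patterns, for which the involution is piecewise linear; \<open>\<mu>\<close>-dominant tableaux
  correspond to Littlewood-Richardson tableaux by exchanging letters and row indices.
\<close>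

subsection \<open>Gelfand-Tsetlin patterns and Bender-Knuth involutions\<close>

text \<open>The obstacle is the passage between the finite and the infinite: the rule is an identity
  in finitely many variables, whereas \<open>schur_zeta\<close> sums over tableaux with unbounded
  entries. No limit in the number of variables is taken. Only finitely many tableaux share a given
  multiset of entries, so one monomial is compared at a time, with a number \<open>N\<close> of
  variables chosen for that monomial. Equal cardinalities of all fibres give a content-preserving
  bijection of the two infinite index sets, and the infinite sums are merely reindexed. Convergence
  is robust because every variable has real part greater than 1, so each series stays absolutely
  convergent under every permutation of the variables. Cancelling the alternant of \<delta> requires
  it to be nonzero in a ring without zero divisors; hence the variables are polynomial
  indeterminates there, and not numbers. The exchange of letters and row indices is forced by a
  mismatch: the cancellation counts tableaux of the straight shape \<nu>, but
  \<open>LR_coeff\<close> counts skew tableaux of shape \<lambda>/\<mu>.\<close>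

text \<open>
  Rows, letters and parts are indexed from 0, so that letter \<open>k\<close> stands for the entry \<open>k + 1\<close>:
  \<open>g i k\<close> counts the entries at most \<open>k\<close> in row \<open>i + 1\<close> of a tableau, including the \<open>\<alpha> i\<close> boxes
  of the inner shape, so the columns of \<open>g\<close> are the shapes of a Gelfand-Tsetlin pattern. The total
  functions in \<open>patterns\<close> need no extensionality condition, as they are constant in \<open>k\<close> from \<open>N\<close> on.
\<close>

definition patterns :: "nat \<Rightarrow> (nat \<Rightarrow> nat) \<Rightarrow> (nat \<Rightarrow> nat) \<Rightarrow> (nat \<Rightarrow> nat \<Rightarrow> nat) set" where
  "patterns N \<alpha> \<beta> = {g. (\<forall>i. g i 0 = \<alpha> i) \<and> (\<forall>i k. N \<le> k \<longrightarrow> g i k = \<beta> i) \<and>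
     (\<forall>i k. g i k \<le> g i (Suc k)) \<and> (\<forall>i k. g (Suc i) (Suc k) \<le> g i k)}"

definition pattern_weight :: "nat \<Rightarrow> (nat \<Rightarrow> nat \<Rightarrow> nat) \<Rightarrow> nat \<Rightarrow> nat" where
  "pattern_weight N g k = (\<Sum>i<N. g i (Suc k) - g i k)"

lemma patternsD:
  assumes "g \<in> patterns N \<alpha> \<beta>"
  shows "g i 0 = \<alpha> i" "N \<le> k \<Longrightarrow> g i k = \<beta> i" "g i k \<le> g i (Suc k)" "g (Suc i) (Suc k) \<le> g i k"
  using assms by (auto simp: patterns_def)

lemma patterns_mono:
  assumes "g \<in> patterns N \<alpha> \<beta>" "k \<le> l"
  shows "g i k \<le> g i l"
  using assms(2) by (rule lift_Suc_mono_le[rotated]) (rule patternsD(3)[OF assms(1)])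

lemma patterns_le:
  assumes "g \<in> patterns N \<alpha> \<beta>"
  shows "g i k \<le> \<beta> i"
  using patterns_mono[OF assms, of k "max k N" i] patternsD(2)[OF assms, of "max k N" i] by simp

text \<open>Entries grow by at least one per step down a column, and every column of a straight
  shape starts in the top row. So row \<open>i\<close>, counted from 0, holds only entries greater
  than \<open>i\<close>.\<close>

lemma patterns_straight_zero:
  assumes "g \<in> patterns N (\<lambda>_. 0) \<nu>" "k \<le> i"
  shows "g i k = 0"
  using assms(2)
proof (induction k arbitrary: i)
  case 0
  then show ?case using patternsD(1)[OF assms(1)] by simp
next
  case (Suc k)
  then obtain j where j: "i = Suc j" by (cases i) auto
  have "g j k = 0" using Suc j by auto
  then show ?case using patternsD(4)[OF assms(1), of j k] j by simp
qed

lemma patterns_straight_row_zero: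
  assumes "g \<in> patterns N (\<lambda>_. 0) \<nu>" "N \<le> i"
  shows "g i k = 0"
proof -
  have "\<nu> i = 0"
    using patterns_straight_zero[OF assms] patternsD(2)[OF assms(1), of N i] by simp
  then show ?thesis using patterns_le[OF assms(1), of i k] by simp
qed

lemma finite_patterns_straight: "finite (patterns N (\<lambda>_. 0) \<nu>)"
proof -
  define B where "B = (\<Sum>i<N. \<nu> i)"
  \<comment> \<open>Outside an \<open>N\<close> by \<open>N\<close> grid the values are forced, by
    the outer shape from step \<open>N\<close> on and by 0 from row \<open>N\<close> on;
    \<open>F\<close> recovers a pattern from its restriction to the grid.\<close>
  define F where "F = (\<lambda>h i k. if i < N then (if k < N then h (i, k) else \<nu> i) else (0::nat))"
  have "patterns N (\<lambda>_. 0) \<nu> \<subseteq> F ` ({..<N} \<times> {..<N} \<rightarrow>\<^sub>E {..B})"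
  proof
    fix g assume g: "g \<in> patterns N (\<lambda>_. 0) \<nu>"
    have "\<nu> i \<le> B" if "i < N" for i
      unfolding B_def using that by (intro member_le_sum) auto
    then have "g i k \<le> B" if "i < N" for i k
      using patterns_le[OF g, of i k] that order_trans by blast
    then have "restrict (\<lambda>(i, k). g i k) ({..<N} \<times> {..<N}) \<in> {..<N} \<times> {..<N} \<rightarrow>\<^sub>E {..B}"
      by auto
    moreover have "g = F (restrict (\<lambda>(i, k). g i k) ({..<N} \<times> {..<N}))"
      using patterns_straight_row_zero[OF g] patternsD(2)[OF g] by (auto simp: F_def fun_eq_iff)
    ultimately show "g \<in> F ` ({..<N} \<times> {..<N} \<rightarrow>\<^sub>E {..B})" by blast
  qed
  then show ?thesis by (rule finite_subset) (intro finite_imageI finite_PiE, auto)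
qed

lemma pattern_weight_int:
  assumes "g \<in> patterns N \<alpha> \<beta>"
  shows "int (pattern_weight n g k) = (\<Sum>i<n. int (g i (Suc k))) - (\<Sum>i<n. int (g i k))"
  by (simp add: pattern_weight_def of_nat_diff patternsD(3)[OF assms] sum_subtractf)

text \<open>
  Column \<open>k + 1\<close> of a pattern can vary between bounds depending on its neighbouring columns;
  reflecting its entries in these intervals is the Bender-Knuth involution. Here it acts only on
  the rows from \<open>i\<close> on, and \<open>c\<close> replaces the upper bound in row \<open>i\<close>, which freezes the entries of
  row \<open>i\<close> beyond box \<open>c\<close>.
\<close>

definition toggle :: "nat \<Rightarrow> nat \<Rightarrow> nat \<Rightarrow> (nat \<Rightarrow> nat \<Rightarrow> nat) \<Rightarrow> nat \<Rightarrow> nat \<Rightarrow> nat" where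
  "toggle k i c g = (\<lambda>j m. if m = Suc k \<and> i \<le> j
     then max (g j k) (g (Suc j) (Suc (Suc k)))
          + (if j = i then c else min (g j (Suc (Suc k))) (g (j - 1) k)) - g j (Suc k)
     else g j m)"

text \<open>\<open>c\<close> must not exceed the two upper bounds that it replaces, nor cut off the
  present entry. As \<open>c\<close> is used in row \<open>i\<close>, the truncated
  \<open>j - 1\<close> in \<open>toggle\<close> matters only for positive \<open>j\<close>.\<close>

definition toggleable :: "nat \<Rightarrow> nat \<Rightarrow> nat \<Rightarrow> (nat \<Rightarrow> nat \<Rightarrow> nat) \<Rightarrow> bool" where
  "toggleable k i c g \<longleftrightarrow> g i (Suc k) \<le> c \<and> c \<le> g i (Suc (Suc k)) \<and> (0 < i \<longrightarrow> c \<le> g (i - 1) k)"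

lemma toggle_interval:
  assumes g: "g \<in> patterns N \<alpha> \<beta>" and c: "toggleable k i c g" and "i \<le> j"
  defines "u \<equiv> (if j = i then c else min (g j (Suc (Suc k))) (g (j - 1) k))"
  shows "max (g j k) (g (Suc j) (Suc (Suc k))) \<le> g j (Suc k)" "g j (Suc k) \<le> u"
    "u \<le> g j (Suc (Suc k))" "0 < j \<Longrightarrow> u \<le> g (j - 1) k"
  using assms(3) c patternsD(3)[OF g, of j k] patternsD(3)[OF g, of j "Suc k"]
    patternsD(4)[OF g, of j "Suc k"] patternsD(4)[OF g, of "j - 1" k]
  by (auto simp: u_def toggleable_def)

lemma toggle_bounds:
  assumes g: "g \<in> patterns N \<alpha> \<beta>" and c: "toggleable k i c g" and j: "i \<le> j"
  shows "g j k \<le> toggle k i c g j (Suc k)" "g (Suc j) (Suc (Suc k)) \<le> toggle k i c g j (Suc k)"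
    "toggle k i c g j (Suc k) \<le> g j (Suc (Suc k))"
    "0 < j \<Longrightarrow> toggle k i c g j (Suc k) \<le> g (j - 1) k"
    "j = i \<Longrightarrow> toggle k i c g j (Suc k) \<le> c"
  using toggle_interval[OF assms] j by (auto simp: toggle_def)

lemma toggle_other: "m \<noteq> Suc k \<or> j < i \<Longrightarrow> toggle k i c g j m = g j m"
  by (auto simp: toggle_def)

lemma toggle_in_patterns:
  assumes g: "g \<in> patterns N \<alpha> \<beta>" and c: "toggleable k i c g" and k: "Suc k < N"
  shows "toggle k i c g \<in> patterns N \<alpha> \<beta>"
proof -
  let ?h = "toggle k i c g"
  have 1: "?h j m \<le> ?h j (Suc m)" for j m
  proof (cases "i \<le> j \<and> (m = k \<or> m = Suc k)")
    case True
    then show ?thesis using toggle_bounds[OF g c, of j] by (auto simp: toggle_other)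
  next
    case False
    then show ?thesis using patternsD(3)[OF g] by (auto simp: toggle_def)
  qed
  have 2: "?h (Suc j) (Suc m) \<le> ?h j m" for j m
  proof (cases "i \<le> Suc j \<and> m = k")
    case True
    then show ?thesis using toggle_bounds(4)[OF g c, of "Suc j"] by (auto simp: toggle_other)
  next
    case F: False
    show ?thesis
    proof (cases "i \<le> j \<and> m = Suc k")
      case True
      then show ?thesis using toggle_bounds(2)[OF g c, of "j"] by (auto simp: toggle_other)
    next
      case False
      then show ?thesis using F patternsD(4)[OF g] by (auto simp: toggle_def)
    qed
  qed
  have "?h j 0 = \<alpha> j" "N \<le> m \<Longrightarrow> ?h j m = \<beta> j" for j m
    using patternsD(1,2)[OF g] k by (auto simp: toggle_other)
  with 1 2 show ?thesis by (auto simp: patterns_def)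
qed

text \<open>Both ends of each interval come from columns \<open>k\<close> and \<open>k + 2\<close>
  or are \<open>c\<close>, while only column \<open>k + 1\<close> changes; the second reflection
  therefore takes place in the same intervals.\<close>

lemma toggle_toggle:
  assumes g: "g \<in> patterns N \<alpha> \<beta>" and c: "toggleable k i c g"
  shows "toggle k i c (toggle k i c g) = g"
proof (intro ext)
  fix j m
  show "toggle k i c (toggle k i c g) j m = g j m"
  proof (cases "i \<le> j \<and> m = Suc k")
    case True
    then show ?thesis
      using toggle_interval[OF g c, of j] by (auto simp: toggle_def)
  qed (auto simp: toggle_def)
qed

text \<open>The lower end for row \<open>j\<close> and the upper end for row \<open>j + 1\<close>
  are the maximum and the minimum of the same numbers \<open>g j k\<close> and
  \<open>g (j + 1) (k + 2)\<close>. They add up to the sum of these two, so no maximum or minimum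
  survives in the total.\<close>

lemma toggle_sum:
  assumes g: "g \<in> patterns N (\<lambda>_. 0) \<nu>" and c: "toggleable k i c g" and i: "i < N"
  shows "(\<Sum>j<N. int (toggle k i c g j (Suc k))) =
    int c + (\<Sum>j<i. int (g j (Suc k)))
    + (\<Sum>j\<in>{i..<N}. int (g j k)) + (\<Sum>j\<in>{Suc i..<N}. int (g j (Suc (Suc k))))
    - (\<Sum>j\<in>{i..<N}. int (g j (Suc k)))"
proof -
  let ?h = "toggle k i c g"
  have row: "int (?h j (Suc k)) = max (int (g j k)) (int (g (Suc j) (Suc (Suc k))))
      + (if j = i then int c else min (int (g j (Suc (Suc k)))) (int (g (j - 1) k)))
      - int (g j (Suc k))" if "i \<le> j" for j
    using toggle_interval[OF g c that] that by (auto simp: toggle_def)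
  have tel: "(\<Sum>j\<in>{i..<n}. int (?h j (Suc k))) + (\<Sum>j\<in>{i..<n}. int (g j (Suc k)))
      + min (int (g n (Suc (Suc k)))) (int (g (n - 1) k)) =
      int c + (\<Sum>j\<in>{i..<n}. int (g j k)) + (\<Sum>j\<in>{Suc i..<n}. int (g j (Suc (Suc k))))
      + int (g n (Suc (Suc k)))" if "Suc i \<le> n" for n
    using that
  proof (induction n rule: dec_induct)
    case base
    then show ?case by (simp add: row)
  next
    case (step n)
    then show ?case using row[of n] by simp
  qed
  have "g N (Suc (Suc k)) = 0"
    using patterns_straight_row_zero[OF g] by simp
  moreover have "(\<Sum>j<N. int (?h j (Suc k))) = (\<Sum>j<i. int (?h j (Suc k))) + (\<Sum>j\<in>{i..<N}. int (?h j (Suc k)))"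
    using i by (simp add: sum.atLeastLessThan_concat lessThan_atLeast0)
  moreover have "(\<Sum>j<i. int (?h j (Suc k))) = (\<Sum>j<i. int (g j (Suc k)))"
    by (intro sum.cong) (auto simp: toggle_other)
  ultimately show ?thesis using tel[of N] i by simp
qed

subsection \<open>Schur polynomials and alternants\<close>

definition schur_poly :: "nat \<Rightarrow> (nat \<Rightarrow> 'a::comm_ring_1) \<Rightarrow> (nat \<Rightarrow> nat) \<Rightarrow> 'a" where
  "schur_poly N x \<nu> = (\<Sum>g\<in>patterns N (\<lambda>_. 0) \<nu>. \<Prod>i<N. x i ^ pattern_weight N g i)"

text \<open>The Leibniz expansion of the determinant with entries \<open>x i ^ e j\<close>.\<close>

definition alternant :: "nat \<Rightarrow> (nat \<Rightarrow> 'a::comm_ring_1) \<Rightarrow> (nat \<Rightarrow> nat) \<Rightarrow> 'a" where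
  "alternant N x e = (\<Sum>w | w permutes {..<N}. of_int (sign w) * (\<Prod>i<N. x i ^ e (w i)))"

lemma toggle_weight:
  assumes g: "g \<in> patterns N (\<lambda>_. 0) \<nu>" and c: "toggleable k i c g" and k: "Suc k < N"
  shows "m \<noteq> k \<Longrightarrow> m \<noteq> Suc k \<Longrightarrow> pattern_weight N (toggle k i c g) m = pattern_weight N g m"
    and "pattern_weight N (toggle k i c g) k + pattern_weight N (toggle k i c g) (Suc k)
      = pattern_weight N g k + pattern_weight N g (Suc k)"
proof -
  show "pattern_weight N (toggle k i c g) m = pattern_weight N g m" if "m \<noteq> k" "m \<noteq> Suc k"
    using that by (simp add: pattern_weight_def toggle_other)
  note h = toggle_in_patterns[OF g c k]
  have "int (pattern_weight N (toggle k i c g) k + pattern_weight N (toggle k i c g) (Suc k))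
      = int (pattern_weight N g k + pattern_weight N g (Suc k))"
    unfolding of_nat_add pattern_weight_int[OF g] pattern_weight_int[OF h]
    by (simp add: toggle_other)
  then show "pattern_weight N (toggle k i c g) k + pattern_weight N (toggle k i c g) (Suc k)
      = pattern_weight N g k + pattern_weight N g (Suc k)" by linarith
qed

text \<open>Starting in row 0 with its true upper bound as \<open>c\<close> freezes nothing. This is
  the classical Bender-Knuth involution, which exchanges the multiplicities of two adjacent
  letters.\<close>

lemma toggle_weight_transpose:
  assumes g: "g \<in> patterns N (\<lambda>_. 0) \<nu>" and k: "Suc k < N"
  defines "h \<equiv> toggle k 0 (g 0 (Suc (Suc k))) g"
  shows "h \<in> patterns N (\<lambda>_. 0) \<nu>" "toggle k 0 (h 0 (Suc (Suc k))) h = g"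
    "pattern_weight N h m = pattern_weight N g (Transposition.transpose k (Suc k) m)"
proof -
  have c: "toggleable k 0 (g 0 (Suc (Suc k))) g"
    using patternsD(3)[OF g] by (simp add: toggleable_def)
  show h: "h \<in> patterns N (\<lambda>_. 0) \<nu>"
    unfolding h_def by (rule toggle_in_patterns[OF g c k])
  have "h 0 (Suc (Suc k)) = g 0 (Suc (Suc k))" by (simp add: h_def toggle_other)
  then show "toggle k 0 (h 0 (Suc (Suc k))) h = g"
    unfolding h_def using toggle_toggle[OF g c] by simp
  have N: "{..<N} = insert 0 {Suc 0..<N}" "{0..<N} = {..<N}"
    using k by auto
  have "int (pattern_weight N h k) = int (pattern_weight N g (Suc k))"
    unfolding pattern_weight_int[OF g] pattern_weight_int[OF h]
    using toggle_sum[OF g c] k by (simp add: h_def toggle_other N)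
  moreover have "pattern_weight N h k + pattern_weight N h (Suc k) = pattern_weight N g k + pattern_weight N g (Suc k)"
    unfolding h_def by (rule toggle_weight[OF g c k])
  ultimately have "pattern_weight N h k = pattern_weight N g (Suc k)"
    "pattern_weight N h (Suc k) = pattern_weight N g k" by linarith+
  then show "pattern_weight N h m = pattern_weight N g (Transposition.transpose k (Suc k) m)"
    using toggle_weight(1)[OF g c k, of m] by (auto simp: Transposition.transpose_def h_def)
qed

lemma prod_power_permutes:
  fixes x :: "'b \<Rightarrow> 'a::comm_monoid_mult"
  assumes "w permutes A"
  shows "(\<Prod>i\<in>A. x (w i) ^ e i) = (\<Prod>i\<in>A. x i ^ e (inv w i))"
  using prod.permute[OF assms, of "\<lambda>i. x i ^ e (inv w i)"] permutes_inverses[OF assms]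
  by (simp add: comp_def)

lemma schur_poly_adjacent:
  assumes k: "Suc k < N"
  shows "schur_poly N (x \<circ> Transposition.transpose k (Suc k)) \<nu> = schur_poly N x \<nu>"
proof -
  let ?t = "Transposition.transpose k (Suc k)"
  have "(\<Prod>i<N. (x \<circ> ?t) i ^ pattern_weight N g i) = (\<Prod>i<N. x i ^ pattern_weight N g (?t i))" for g
    using prod_power_permutes[of ?t "{..<N}" x] k by (simp add: permutes_swap_id)
  then have "schur_poly N (x \<circ> ?t) \<nu> =
      (\<Sum>g\<in>patterns N (\<lambda>_. 0) \<nu>. \<Prod>i<N. x i ^ pattern_weight N g (?t i))"
    by (simp add: schur_poly_def)
  also have "\<dots> = schur_poly N x \<nu>"
    unfolding schur_poly_def
    by (rule sum.reindex_bij_witness[of _ "\<lambda>g. toggle k 0 (g 0 (Suc (Suc k))) g"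
          "\<lambda>g. toggle k 0 (g 0 (Suc (Suc k))) g"])
      (simp_all add: toggle_weight_transpose k)
  finally show ?thesis .
qed

lemma schur_poly_transpose:
  assumes "a < N" "b < N"
  shows "schur_poly N (x \<circ> Transposition.transpose a b) \<nu> = schur_poly N x \<nu>"
proof -
  have main: "schur_poly N (x \<circ> Transposition.transpose a (a + d)) \<nu> = schur_poly N x \<nu>"
    if "a + d < N" for a d and x :: "nat \<Rightarrow> 'a"
    using that
  proof (induction d arbitrary: x)
    case 0
    then show ?case by simp
  next
    case (Suc d)
    show ?case
    proof (cases "d = 0")
      case True
      then show ?thesis using Suc.prems schur_poly_adjacent[of a N x] by (simp add: comp_def)
    next
      case False
      let ?s = "Transposition.transpose (a + d) (Suc (a + d))"
      let ?t = "Transposition.transpose a (a + d)"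
      \<comment> \<open>Conjugation by an adjacent transposition shortens the distance by one. For
        \<open>d = 0\<close> the conjugated map would be the identity, hence the case
        distinction.\<close>
      have "Transposition.transpose a (a + Suc d) = ?s \<circ> ?t \<circ> ?s"
        using False by (auto simp: fun_eq_iff Transposition.transpose_def)
      then have "schur_poly N (x \<circ> Transposition.transpose a (a + Suc d)) \<nu> = schur_poly N (((x \<circ> ?s) \<circ> ?t) \<circ> ?s) \<nu>"
        by (simp only: comp_assoc)
      also have "\<dots> = schur_poly N ((x \<circ> ?s) \<circ> ?t) \<nu>"
        using Suc.prems by (intro schur_poly_adjacent) simp
      also have "\<dots> = schur_poly N (x \<circ> ?s) \<nu>"
        using Suc.prems by (intro Suc.IH) simp
      also have "\<dots> = schur_poly N x \<nu>"
        using Suc.prems by (intro schur_poly_adjacent) simp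
      finally show ?thesis .
    qed
  qed
  show ?thesis
    using main[of a "b - a" x] main[of b "a - b" x] assms
    by (cases "a \<le> b") (auto simp: transpose_commute)
qed

lemma schur_poly_permutes:
  assumes "w permutes {..<N}"
  shows "schur_poly N (x \<circ> w) \<nu> = schur_poly N x \<nu>"
  using finite_lessThan assms
proof (induction arbitrary: x rule: permutes_rev_induct)
  case id
  then show ?case by simp
next
  case (swap a b p)
  then have "schur_poly N (x \<circ> p \<circ> Transposition.transpose a b) \<nu> = schur_poly N (x \<circ> p) \<nu>"
    by (intro schur_poly_transpose) auto
  also have "\<dots> = schur_poly N x \<nu>" by (rule swap.IH)
  finally show ?case by (simp only: comp_assoc)
qed

lemma schur_poly_permutes_exponents:
  assumes "w permutes {..<N}"
  shows "(\<Sum>g\<in>patterns N (\<lambda>_. 0) \<nu>. \<Prod>i<N. x i ^ pattern_weight N g (w i)) = schur_poly N x \<nu>"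
proof -
  have "(\<Sum>g\<in>patterns N (\<lambda>_. 0) \<nu>. \<Prod>i<N. x i ^ pattern_weight N g (w i)) =
      schur_poly N (x \<circ> inv w) \<nu>"
    unfolding schur_poly_def
    using prod_power_permutes[OF permutes_inv[OF assms], of x] permutes_inv_inv[OF assms]
    by (simp add: comp_def)
  then show ?thesis using schur_poly_permutes[OF permutes_inv[OF assms]] by simp
qed

text \<open>By symmetry the Schur polynomial may be written differently in each term of the
  alternant, with its exponents permuted by the same \<open>w\<close>. Summing over \<open>w\<close>
  for a fixed pattern then gives one alternant.\<close>

lemma alternant_mult_schur_poly:
  "alternant N x e * schur_poly N x \<nu> =
    (\<Sum>g\<in>patterns N (\<lambda>_. 0) \<nu>. alternant N x (\<lambda>i. e i + pattern_weight N g i))"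
proof -
  have "alternant N x e * schur_poly N x \<nu> =
      (\<Sum>w | w permutes {..<N}. of_int (sign w) * (\<Prod>i<N. x i ^ e (w i)) * schur_poly N x \<nu>)"
    by (simp add: alternant_def sum_distrib_right)
  also have "\<dots> = (\<Sum>w | w permutes {..<N}. \<Sum>g\<in>patterns N (\<lambda>_. 0) \<nu>.
      of_int (sign w) * (\<Prod>i<N. x i ^ (e (w i) + pattern_weight N g (w i))))"
    by (intro sum.cong refl)
      (simp add: schur_poly_permutes_exponents[symmetric] sum_distrib_left power_add prod.distrib mult.assoc)
  also have "\<dots> = (\<Sum>g\<in>patterns N (\<lambda>_. 0) \<nu>. alternant N x (\<lambda>i. e i + pattern_weight N g i))"
    unfolding alternant_def by (rule sum.swap)
  finally show ?thesis .
qed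

lemma alternant_transpose:
  assumes "a < N" "b < N" "a \<noteq> b" "\<And>i. i < N \<Longrightarrow> e' i = e (Transposition.transpose a b i)"
  shows "alternant N x e' = - alternant N x e"
proof -
  let ?t = "Transposition.transpose a b"
  have t: "?t permutes {..<N}" using assms by (simp add: permutes_swap_id)
  have "alternant N x e = (\<Sum>w | w permutes {..<N}. of_int (sign (?t \<circ> w)) * (\<Prod>i<N. x i ^ e ((?t \<circ> w) i)))"
    unfolding alternant_def by (subst setum_permutations_compose_left[OF t]) simp
  also have "\<dots> = (\<Sum>w | w permutes {..<N}. - (of_int (sign w) * (\<Prod>i<N. x i ^ e' (w i))))"
  proof (intro sum.cong refl)
    fix w assume "w \<in> {w. w permutes {..<N}}"
    then have w: "w permutes {..<N}" by simp
    have "sign (?t \<circ> w) = - sign w"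
      using assms t w by (subst sign_compose) (auto simp: sign_swap_id permutation_permutes intro: exI[of _ "{..<N}"])
    moreover have "(\<Prod>i<N. x i ^ e ((?t \<circ> w) i)) = (\<Prod>i<N. x i ^ e' (w i))"
      using assms(4) permutes_in_image[OF w] by (intro prod.cong) auto
    ultimately show "of_int (sign (?t \<circ> w)) * (\<Prod>i<N. x i ^ e ((?t \<circ> w) i)) =
        - (of_int (sign w) * (\<Prod>i<N. x i ^ e' (w i)))" by simp
  qed
  finally show ?thesis by (simp add: alternant_def sum_negf)
qed

section \<open>Cancellation of the patterns that leave the dominant chamber\<close>

text \<open>
  Read the tableau by rows from the top, each row from right to left, and add the letters read to
  \<open>\<mu>\<close>. Then \<open>excess \<mu> g i k\<close> is the amount by which part \<open>k\<close> exceeds part \<open>k + 1\<close> before row \<open>i\<close>, and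
  \<open>violates \<mu> g i k\<close> says that the letters \<open>k + 1\<close> of row \<open>i\<close> use up more than that.
\<close>

definition excess :: "(nat \<Rightarrow> nat) \<Rightarrow> (nat \<Rightarrow> nat \<Rightarrow> nat) \<Rightarrow> nat \<Rightarrow> nat \<Rightarrow> int" where
  "excess \<mu> g i k = int (\<mu> k) - int (\<mu> (Suc k)) +
     (\<Sum>j<i. 2 * int (g j (Suc k)) - int (g j k) - int (g j (Suc (Suc k))))"

definition violates :: "(nat \<Rightarrow> nat) \<Rightarrow> (nat \<Rightarrow> nat \<Rightarrow> nat) \<Rightarrow> nat \<Rightarrow> nat \<Rightarrow> bool" where
  "violates \<mu> g i k \<longleftrightarrow> excess \<mu> g i k < int (g i (Suc (Suc k))) - int (g i (Suc k))"

definition dominant :: "(nat \<Rightarrow> nat) \<Rightarrow> (nat \<Rightarrow> nat \<Rightarrow> nat) \<Rightarrow> bool" where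
  "dominant \<mu> g \<longleftrightarrow> (\<forall>i k. \<not> violates \<mu> g i k)"

text \<open>Within a row larger letters are read first, so the first violation is the one with the
  largest \<open>k\<close>. This also makes it stable: toggling alters row \<open>i\<close> in
  column \<open>k + 1\<close> only, which does not enter the tests for larger letters.\<close>

definition first_violation :: "(nat \<Rightarrow> nat) \<Rightarrow> (nat \<Rightarrow> nat \<Rightarrow> nat) \<Rightarrow> nat \<Rightarrow> nat \<Rightarrow> bool" where
  "first_violation \<mu> g i k \<longleftrightarrow> violates \<mu> g i k \<and> (\<forall>i'<i. \<forall>k'. \<not> violates \<mu> g i' k') \<and>
     (\<forall>k'>k. \<not> violates \<mu> g i k')"

text \<open>
  The number of boxes of row \<open>i\<close> left of the letter at which part \<open>k + 1\<close> first exceeds part \<open>k\<close>.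
\<close>

definition cutoff :: "(nat \<Rightarrow> nat) \<Rightarrow> (nat \<Rightarrow> nat \<Rightarrow> nat) \<Rightarrow> nat \<Rightarrow> nat \<Rightarrow> nat" where
  "cutoff \<mu> g i k = nat (int (g i (Suc (Suc k))) - excess \<mu> g i k - 1)"

context
  fixes N :: nat and \<mu> \<nu> :: "nat \<Rightarrow> nat" and g :: "nat \<Rightarrow> nat \<Rightarrow> nat"
  assumes mu: "\<And>k. \<mu> (Suc k) \<le> \<mu> k" and g: "g \<in> patterns N (\<lambda>_. 0) \<nu>"
begin

text \<open>Once the letters \<open>k + 1\<close> of row \<open>i\<close> have been paid for, its
  letters \<open>k\<close> still raise the excess.\<close>

lemma excess_Suc_ge:
  assumes "\<not> violates \<mu> g i k"
  shows "excess \<mu> g (Suc i) k \<ge> int (g i (Suc k)) - int (g i k)"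
  using assms by (simp add: violates_def excess_def)

lemma excess_nonneg:
  assumes "\<And>i'. i' < i \<Longrightarrow> \<not> violates \<mu> g i' k"
  shows "0 \<le> excess \<mu> g i k"
proof (cases i)
  case 0
  then show ?thesis using mu[of k] by (simp add: excess_def)
next
  case (Suc j)
  then show ?thesis using excess_Suc_ge[of j k] assms[of j] patternsD(3)[OF g, of j k] by simp
qed

text \<open>The excess is nonnegative when row \<open>i\<close> is reached, so a violation needs a
  letter \<open>k + 1\<close> in that row.\<close>

lemma violation_index_less:
  assumes "violates \<mu> g i k" "\<And>i'. i' < i \<Longrightarrow> \<not> violates \<mu> g i' k"
  shows "i < N" "Suc k < N"
proof -
  have *: "g i (Suc k) < g i (Suc (Suc k))"
    using excess_nonneg[of i k] assms by (simp add: violates_def)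
  show "i < N" using patterns_straight_row_zero[OF g, of i] * by (cases "i < N") auto
  show "Suc k < N" using patternsD(2)[OF g] * by (cases "Suc k < N") auto
qed

lemma not_dominant_first_violation:
  assumes "\<not> dominant \<mu> g"
  shows "\<exists>i<N. \<exists>k. Suc k < N \<and> first_violation \<mu> g i k"
proof -
  define i where "i = (LEAST i. \<exists>k. violates \<mu> g i k)"
  have "\<exists>i. \<exists>k. violates \<mu> g i k" using assms by (auto simp: dominant_def)
  then have ex: "\<exists>k. violates \<mu> g i k" unfolding i_def by (rule LeastI_ex)
  have min: "\<not> violates \<mu> g i' k" if "i' < i" for i' k
    using not_less_Least[of i' "\<lambda>i. \<exists>k. violates \<mu> g i k"] that unfolding i_def by blast
  define K where "K = {k. violates \<mu> g i k}"
  have "K \<subseteq> {..N}" using violation_index_less(2) min by (fastforce simp: K_def)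
  then have fin: "finite K" by (rule finite_subset) simp
  have "Max K \<in> K" using fin ex by (intro Max_in) (auto simp: K_def)
  moreover have "k \<notin> K" if "k > Max K" for k using Max_ge[OF fin, of k] that by auto
  ultimately have "first_violation \<mu> g i (Max K)"
    using min by (auto simp: first_violation_def K_def)
  moreover from this have "i < N" "Suc (Max K) < N"
    using violation_index_less[of i "Max K"] min by (simp_all add: first_violation_def)
  ultimately show ?thesis by blast
qed

context
  fixes i k :: nat
  assumes fv: "first_violation \<mu> g i k"
begin

lemma first_violation_index_less: "i < N" "Suc k < N"
  using violation_index_less fv by (auto simp: first_violation_def)

lemma cutoff_int: "int (cutoff \<mu> g i k) = int (g i (Suc (Suc k))) - excess \<mu> g i k - 1"
  using fv by (auto simp: cutoff_def first_violation_def violates_def)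

lemma toggleable_cutoff: "toggleable k i (cutoff \<mu> g i k) g"
proof -
  have "g i (Suc k) \<le> cutoff \<mu> g i k"
    using cutoff_int fv by (simp add: first_violation_def violates_def)
  moreover have "cutoff \<mu> g i k \<le> g i (Suc (Suc k))"
    using cutoff_int excess_nonneg[of i k] fv by (simp add: first_violation_def)
  moreover have "cutoff \<mu> g i k \<le> g (i - 1) k" if "0 < i"
  proof -
    have "excess \<mu> g i k \<ge> int (g (i - 1) (Suc k)) - int (g (i - 1) k)"
      using excess_Suc_ge[of "i - 1" k] fv that by (simp add: first_violation_def)
    then show ?thesis using cutoff_int patternsD(4)[OF g, of "i - 1" "Suc k"] that by simp
  qed
  ultimately show ?thesis by (simp add: toggleable_def)
qed

abbreviation (input) "toggled \<equiv> toggle k i (cutoff \<mu> g i k) g"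

lemma excess_toggled:
  assumes "i' \<le> i"
  shows "excess \<mu> toggled i' k' = excess \<mu> g i' k'"
  using assms by (auto simp: excess_def toggle_other intro!: sum.cong)

lemma first_violation_toggled: "first_violation \<mu> toggled i k"
proof -
  have "toggled i (Suc k) \<le> cutoff \<mu> g i k"
    using toggle_bounds(5)[OF g toggleable_cutoff] by simp
  then have "violates \<mu> toggled i k"
    using cutoff_int by (simp add: violates_def excess_toggled toggle_other)
  moreover have "\<not> violates \<mu> toggled i' k'" if "i' < i" for i' k'
    using fv that by (simp add: first_violation_def violates_def excess_toggled toggle_other)
  moreover have "\<not> violates \<mu> toggled i k'" if "k < k'" for k'
    using fv that by (simp add: first_violation_def violates_def excess_toggled toggle_other)
  ultimately show ?thesis by (simp add: first_violation_def)
qed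

lemma cutoff_toggled: "cutoff \<mu> toggled i k = cutoff \<mu> g i k"
  unfolding cutoff_def[of \<mu> toggled] by (simp add: excess_toggled toggle_other) (simp add: cutoff_def)

text \<open>After the violating letter part \<open>k + 1\<close> is one larger than part
  \<open>k\<close>. In the unread rest the multiplicities of the two letters are exchanged, so the
  totals are exchanged up to this difference of one.\<close>

lemma weight_toggled:
  shows "int (\<mu> k) + int (pattern_weight N toggled k) = int (\<mu> (Suc k)) + int (pattern_weight N g (Suc k)) - 1"
    and "int (\<mu> (Suc k)) + int (pattern_weight N toggled (Suc k)) = int (\<mu> k) + int (pattern_weight N g k) + 1"
proof -
  note c = toggleable_cutoff and ik = first_violation_index_less
  note h = toggle_in_patterns[OF g c ik(2)]
  have split: "(\<Sum>j<N. int (f j)) = (\<Sum>j<i. int (f j)) + int (f i) + (\<Sum>j\<in>{Suc i..<N}. int (f j))"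
    and split': "(\<Sum>j\<in>{i..<N}. int (f j)) = int (f i) + (\<Sum>j\<in>{Suc i..<N}. int (f j))" for f
    using ik(1) sum.atLeastLessThan_concat[of 0 i N "\<lambda>j. int (f j)"]
    by (simp_all add: lessThan_atLeast0 sum.atLeast_Suc_lessThan)
  have "excess \<mu> g i k = int (\<mu> k) - int (\<mu> (Suc k)) + 2 * (\<Sum>j<i. int (g j (Suc k)))
      - (\<Sum>j<i. int (g j k)) - (\<Sum>j<i. int (g j (Suc (Suc k))))"
    by (simp add: excess_def sum_subtractf sum_distrib_left)
  then show 1: "int (\<mu> k) + int (pattern_weight N toggled k) = int (\<mu> (Suc k)) + int (pattern_weight N g (Suc k)) - 1"
    unfolding pattern_weight_int[OF g] pattern_weight_int[OF h] toggle_sum[OF g c ik(1)] cutoff_int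
    by (simp add: toggle_other split split')
  show "int (\<mu> (Suc k)) + int (pattern_weight N toggled (Suc k)) = int (\<mu> k) + int (pattern_weight N g k) + 1"
    using 1 toggle_weight(2)[OF g c ik(2)] by linarith
qed

text \<open>
  At the first violation the parts \<open>k\<close> and \<open>k + 1\<close>, shifted by the staircase, agree. Toggling the
  unread rest of the tableau thus swaps the final exponents at \<open>k\<close> and \<open>k + 1\<close>.
\<close>

lemma alternant_toggled:
  "alternant N x (\<lambda>m. \<mu> m + (N - m) + pattern_weight N toggled m) =
    - alternant N x (\<lambda>m. \<mu> m + (N - m) + pattern_weight N g m)"
proof (rule alternant_transpose[of k _ "Suc k"])
  note ik = first_violation_index_less
  show "k < N" "Suc k < N" using ik by auto
  fix m assume "m < N"
  show "\<mu> m + (N - m) + pattern_weight N toggled m =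
      \<mu> (Transposition.transpose k (Suc k) m) + (N - Transposition.transpose k (Suc k) m)
      + pattern_weight N g (Transposition.transpose k (Suc k) m)"
    using weight_toggled toggle_weight(1)[OF g toggleable_cutoff ik(2), of m] ik
    by (auto simp: Transposition.transpose_def)
qed simp

end

end

lemma sum_first_violation:
  fixes x :: "nat \<Rightarrow> 'a::{idom, ring_char_0}"
  assumes mu: "\<And>k. \<mu> (Suc k) \<le> \<mu> k"
  shows "(\<Sum>g | g \<in> patterns N (\<lambda>_. 0) \<nu> \<and> first_violation \<mu> g i k.
      alternant N x (\<lambda>m. \<mu> m + (N - m) + pattern_weight N g m)) = 0" (is "sum ?f ?A = 0")
proof -
  let ?\<phi> = "\<lambda>g. toggle k i (cutoff \<mu> g i k) g"
  have "sum ?f ?A = (\<Sum>g\<in>?A. - ?f g)"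
  proof (rule sum.reindex_bij_witness[of _ ?\<phi> ?\<phi>])
    fix g assume "g \<in> ?A"
    then have g: "g \<in> patterns N (\<lambda>_. 0) \<nu>" and fv: "first_violation \<mu> g i k" by auto
    note tc = toggleable_cutoff[OF mu g fv]
    have inv: "?\<phi> (?\<phi> g) = g"
      unfolding cutoff_toggled[OF mu g fv] by (rule toggle_toggle[OF g tc])
    moreover have mem: "?\<phi> g \<in> ?A"
      using toggle_in_patterns[OF g tc] first_violation_index_less[OF mu g fv]
        first_violation_toggled[OF mu g fv] by simp
    ultimately show "?\<phi> (?\<phi> g) = g" "?\<phi> g \<in> ?A" "?\<phi> (?\<phi> g) = g" "?\<phi> g \<in> ?A" by blast+
    show "- ?f (?\<phi> g) = ?f g"
      using alternant_toggled[OF mu g fv, of x] by simp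
  qed
  \<comment> \<open>The sum equals its own negative, and 2 can be cancelled in an integral domain of
    characteristic zero.\<close>
  then show ?thesis by (simp add: sum_negf eq_neg_iff_add_eq_0)
qed

lemma first_violation_unique:
  assumes "first_violation \<mu> g i k" "first_violation \<mu> g i' k'"
  shows "i = i' \<and> k = k'"
  using assms unfolding first_violation_def by (metis linorder_neqE_nat)

lemma sum_not_dominant:
  fixes x :: "nat \<Rightarrow> 'a::{idom, ring_char_0}"
  assumes mu: "\<And>k. \<mu> (Suc k) \<le> \<mu> k"
  shows "(\<Sum>g | g \<in> patterns N (\<lambda>_. 0) \<nu> \<and> \<not> dominant \<mu> g.
      alternant N x (\<lambda>m. \<mu> m + (N - m) + pattern_weight N g m)) = 0" (is "sum ?f ?A = 0")
proof -
  let ?B = "\<lambda>(i, k). {g \<in> patterns N (\<lambda>_. 0) \<nu>. first_violation \<mu> g i k}"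
  have "?A = \<Union> (?B ` ({..<N} \<times> {..<N}))"
  proof (intro equalityI subsetI)
    fix g assume "g \<in> ?A"
    then show "g \<in> \<Union> (?B ` ({..<N} \<times> {..<N}))"
      using not_dominant_first_violation[of \<mu> g N \<nu>] mu Suc_lessD by fastforce
  next
    fix g assume "g \<in> \<Union> (?B ` ({..<N} \<times> {..<N}))"
    then show "g \<in> ?A" by (auto simp: first_violation_def dominant_def)
  qed
  moreover have "sum ?f (\<Union> (?B ` ({..<N} \<times> {..<N}))) = (\<Sum>p\<in>{..<N} \<times> {..<N}. sum ?f (?B p))"
    by (rule sum.UNION_disjoint) (use finite_patterns_straight first_violation_unique in auto)
  moreover have "sum ?f (?B p) = 0" for p
    using sum_first_violation[of \<mu>] mu by (cases p) simp
  ultimately show ?thesis by simp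
qed

lemma alternant_mult_schur_poly_dominant:
  fixes x :: "nat \<Rightarrow> 'a::{idom, ring_char_0}"
  assumes mu: "\<And>k. \<mu> (Suc k) \<le> \<mu> k"
  shows "alternant N x (\<lambda>m. \<mu> m + (N - m)) * schur_poly N x \<nu> =
    (\<Sum>g | g \<in> patterns N (\<lambda>_. 0) \<nu> \<and> dominant \<mu> g.
      alternant N x (\<lambda>m. \<mu> m + pattern_weight N g m + (N - m)))"
proof -
  let ?P = "patterns N (\<lambda>_. 0) \<nu>" and ?f = "\<lambda>g. alternant N x (\<lambda>m. \<mu> m + (N - m) + pattern_weight N g m)"
  have "alternant N x (\<lambda>m. \<mu> m + (N - m)) * schur_poly N x \<nu> = sum ?f ?P"
    by (rule alternant_mult_schur_poly)
  also have "\<dots> = sum ?f {g. g \<in> ?P \<and> dominant \<mu> g} + sum ?f {g. g \<in> ?P \<and> \<not> dominant \<mu> g}"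
    by (subst sum.union_disjoint[symmetric]) (auto simp: finite_patterns_straight intro!: sum.cong)
  finally show ?thesis using sum_not_dominant[where \<mu> = \<mu> and N = N and \<nu> = \<nu> and x = x] mu by (simp add: add_ac)
qed

section \<open>The bialternant formula\<close>

text \<open>Every row \<open>i\<close> consists of letters \<open>i\<close>. By induction the rows
  above contain neither \<open>k\<close> nor \<open>k + 1\<close> if \<open>i \<le> k\<close>;
  starting from the empty shape the excess is then 0, and row \<open>i\<close> cannot afford a
  letter \<open>k + 1\<close>.\<close>

lemma dominant_zero_pattern:
  assumes g: "g \<in> patterns N (\<lambda>_. 0) \<nu>" and dom: "dominant (\<lambda>_. 0) g"
  shows "g i k = (if k \<le> i then 0 else \<nu> i)"
proof -
  have const: "g i (Suc (Suc k)) = g i (Suc k)" if "i \<le> k" for i k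
    using that
  proof (induction i arbitrary: k rule: less_induct)
    case (less i)
    have "g j (Suc k) = g j k \<and> g j (Suc (Suc k)) = g j (Suc k)" if "j < i" for j
      using less.IH[OF that, of "k - 1"] less.IH[OF that, of k] that less.prems by (cases k) auto
    then have "excess (\<lambda>_. 0) g i k = 0"
      by (auto simp: excess_def intro!: sum.neutral)
    moreover have "\<not> violates (\<lambda>_. 0) g i k" using dom by (simp add: dominant_def)
    ultimately show ?case
      using patternsD(3)[OF g, of i "Suc k"] by (simp add: violates_def)
  qed
  have d: "g i (Suc i + d) = g i (Suc i)" for d
    by (induction d) (use const[of i] in auto)
  have "g i (Suc i + N) = \<nu> i" using patternsD(2)[OF g] by simp
  then have "g i k = \<nu> i" if "i < k"
    using that d[of "k - Suc i"] d[of N] by simp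
  then show ?thesis using patterns_straight_zero[OF g] by simp
qed

lemma dominant_zero_patterns:
  assumes nu: "\<And>k. \<nu> (Suc k) \<le> \<nu> k" "\<And>k. N \<le> k \<Longrightarrow> \<nu> k = 0"
  shows "{g. g \<in> patterns N (\<lambda>_. 0) \<nu> \<and> dominant (\<lambda>_. 0) g} = {\<lambda>i k. if k \<le> i then 0 else \<nu> i}"
    (is "?A = {?g}")
proof -
  have "?g \<in> patterns N (\<lambda>_. 0) \<nu>"
    using nu by (auto simp: patterns_def)
  moreover have excess: "excess (\<lambda>_. 0) ?g i k = (if k < i then int (\<nu> k) else 0) - (if Suc k < i then int (\<nu> (Suc k)) else 0)" for i k
    by (induction i) (auto simp: excess_def not_le less_Suc_eq_le dest: le_antisym)
  have "\<not> violates (\<lambda>_. 0) ?g i k" for i k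
    using excess[of i k] nu(1)[of k] by (cases "i = Suc k") (auto simp: violates_def)
  then have "dominant (\<lambda>_. 0) ?g" by (simp add: dominant_def)
  ultimately show ?thesis
    using dominant_zero_pattern by (fastforce simp: fun_eq_iff)
qed

text \<open>For the empty starting shape one dominant pattern is left, with content \<nu>. The
  exponents \<open>N - m\<close> are the usual staircase raised by one, which multiplies both
  alternants by the product of the variables.\<close>

lemma alternant_staircase_mult_schur_poly:
  fixes x :: "nat \<Rightarrow> 'a::{idom, ring_char_0}"
  assumes nu: "\<And>k. \<nu> (Suc k) \<le> \<nu> k" "\<And>k. N \<le> k \<Longrightarrow> \<nu> k = 0"
  shows "alternant N x (\<lambda>m. N - m) * schur_poly N x \<nu> = alternant N x (\<lambda>m. \<nu> m + (N - m))"
proof -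
  let ?g = "\<lambda>i k. if k \<le> i then 0 else \<nu> i"
  have "pattern_weight N ?g k = \<nu> k" if "k < N" for k
  proof -
    have "pattern_weight N ?g k = (\<Sum>i<N. if i = k then \<nu> k else 0)"
      unfolding pattern_weight_def by (intro sum.cong) auto
    then show ?thesis using that by simp
  qed
  then have "alternant N x (\<lambda>m. pattern_weight N ?g m + (N - m)) = alternant N x (\<lambda>m. \<nu> m + (N - m))"
    using permutes_in_image[of _ "{..<N}"]
    by (auto simp: alternant_def intro!: sum.cong prod.cong)
  then show ?thesis
    using alternant_mult_schur_poly_dominant[where \<mu> = "\<lambda>_. 0" and N = N and x = x and \<nu> = \<nu>]
      dominant_zero_patterns[of \<nu> N] nu by simp
qed

text \<open>Row \<open>N\<close> is empty, so dominance there concerns the content of the whole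
  tableau.\<close>

lemma dominant_shape:
  assumes g: "g \<in> patterns N (\<lambda>_. 0) \<nu>" and dom: "dominant \<mu> g"
  shows "\<mu> (Suc k) + pattern_weight N g (Suc k) \<le> \<mu> k + pattern_weight N g k"
    and "N \<le> k \<Longrightarrow> pattern_weight N g k = 0"
proof -
  have "0 \<le> excess \<mu> g N k"
    using dom[unfolded dominant_def violates_def not_less, rule_format, of N k]
      patterns_straight_row_zero[OF g, of N] by simp
  also have "excess \<mu> g N k = int (\<mu> k) + int (pattern_weight N g k) - int (\<mu> (Suc k)) - int (pattern_weight N g (Suc k))"
    by (simp add: excess_def pattern_weight_int[OF g] sum_subtractf sum_distrib_left)
  finally show "\<mu> (Suc k) + pattern_weight N g (Suc k) \<le> \<mu> k + pattern_weight N g k" by linarith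
  show "N \<le> k \<Longrightarrow> pattern_weight N g k = 0"
    using patternsD(2)[OF g] by (simp add: pattern_weight_def)
qed

lemma schur_poly_mult:
  fixes x :: "nat \<Rightarrow> 'a::{idom, ring_char_0}"
  assumes mu: "\<And>k. \<mu> (Suc k) \<le> \<mu> k" "\<And>k. N \<le> k \<Longrightarrow> \<mu> k = 0"
    and nonzero: "alternant N x (\<lambda>m. N - m) \<noteq> 0"
  shows "schur_poly N x \<mu> * schur_poly N x \<nu> =
    (\<Sum>g | g \<in> patterns N (\<lambda>_. 0) \<nu> \<and> dominant \<mu> g. schur_poly N x (\<lambda>k. \<mu> k + pattern_weight N g k))"
proof -
  let ?\<delta> = "alternant N x (\<lambda>m. N - m)" and ?D = "{g. g \<in> patterns N (\<lambda>_. 0) \<nu> \<and> dominant \<mu> g}"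
  have "?\<delta> * (schur_poly N x \<mu> * schur_poly N x \<nu>) = alternant N x (\<lambda>m. \<mu> m + (N - m)) * schur_poly N x \<nu>"
    using alternant_staircase_mult_schur_poly[where \<nu> = \<mu> and N = N and x = x] mu by (simp flip: mult.assoc)
  also have "\<dots> = (\<Sum>g\<in>?D. alternant N x (\<lambda>m. \<mu> m + pattern_weight N g m + (N - m)))"
    using alternant_mult_schur_poly_dominant[where \<mu> = \<mu> and N = N and x = x and \<nu> = \<nu>] mu by simp
  also have "\<dots> = (\<Sum>g\<in>?D. ?\<delta> * schur_poly N x (\<lambda>k. \<mu> k + pattern_weight N g k))"
  proof (intro sum.cong refl)
    fix g assume "g \<in> ?D"
    then show "alternant N x (\<lambda>m. \<mu> m + pattern_weight N g m + (N - m)) =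
        ?\<delta> * schur_poly N x (\<lambda>k. \<mu> k + pattern_weight N g k)"
      using dominant_shape[of g N \<nu> \<mu>] mu
      by (intro alternant_staircase_mult_schur_poly[symmetric]) auto
  qed
  finally show ?thesis
    using nonzero by (simp flip: sum_distrib_left)
qed

section \<open>Comparison of coefficients in integer polynomials\<close>

type_synonym int_mpoly = "(nat \<Rightarrow>\<^sub>0 nat) \<Rightarrow>\<^sub>0 int"

definition indet :: "nat \<Rightarrow> int_mpoly" where
  "indet i = Poly_Mapping.single (Poly_Mapping.single i 1) 1"

definition exponent :: "nat \<Rightarrow> (nat \<Rightarrow> nat) \<Rightarrow> nat \<Rightarrow>\<^sub>0 nat" where
  "exponent N e = (\<Sum>i<N. Poly_Mapping.single i (e i))"

lemma lookup_exponent: "Poly_Mapping.lookup (exponent N e) i = (if i < N then e i else 0)"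
proof -
  have "Poly_Mapping.lookup (exponent N e) i = (\<Sum>j<N. if j = i then e i else 0)"
    unfolding exponent_def Poly_Mapping.lookup_sum by (intro sum.cong) (auto simp: lookup_single when_def)
  then show ?thesis by simp
qed

lemma exponent_eq_iff: "exponent N e = exponent N e' \<longleftrightarrow> (\<forall>i<N. e i = e' i)"
  by (auto simp: poly_mapping_eq_iff fun_eq_iff lookup_exponent)

lemma prod_indet: "(\<Prod>i<N. indet i ^ e i) = Poly_Mapping.single (exponent N e) 1"
proof -
  have "indet i ^ k = Poly_Mapping.single (Poly_Mapping.single i k) 1" for i k
    by (induction k) (simp_all add: indet_def mult_single flip: single_add)
  moreover have "(\<Prod>i\<in>A. Poly_Mapping.single (Poly_Mapping.single i (e i)) (1::int)) =
      Poly_Mapping.single (\<Sum>i\<in>A. Poly_Mapping.single i (e i)) 1" for A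
    by (induction A rule: infinite_finite_induct) (simp_all add: mult_single)
  ultimately show ?thesis by (simp add: exponent_def)
qed

text \<open>Different permutations yield different exponent vectors, so the monomial of the identity
  keeps the coefficient 1.\<close>

lemma alternant_indet_nonzero: "alternant N indet (\<lambda>m. N - m) \<noteq> 0"
proof -
  let ?P = "{w. w permutes {..<N}}" and ?m = "\<lambda>w. exponent N (\<lambda>i. N - w i)"
  have "Poly_Mapping.lookup (alternant N indet (\<lambda>m. N - m)) (?m id) =
      (\<Sum>w\<in>?P. Poly_Mapping.lookup (Poly_Mapping.single 0 (sign w) * Poly_Mapping.single (?m w) 1) (?m id))"
    unfolding alternant_def Poly_Mapping.lookup_sum prod_indet by (simp flip: single_of_int)
  also have "\<dots> = (\<Sum>w\<in>?P. if w = id then 1 else 0)"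
  proof (intro sum.cong refl)
    fix w assume "w \<in> ?P"
    then have w: "w permutes {..<N}" by simp
    have "?m w = ?m id \<longleftrightarrow> w = id"
    proof
      assume "?m w = ?m id"
      then have "w i = i" if "i < N" for i
        using that permutes_in_image[OF w, of i] by (auto simp: exponent_eq_iff)
      moreover have "w i = i" if "\<not> i < N" for i
        using w that by (auto simp: permutes_def)
      ultimately show "w = id" by (auto simp: fun_eq_iff)
    qed simp
    then show "Poly_Mapping.lookup (Poly_Mapping.single 0 (sign w) * Poly_Mapping.single (?m w) 1) (?m id) =
        (if w = id then 1 else 0)"
      by (auto simp: mult_single lookup_single when_def)
  qed
  also have "\<dots> = 1" by (simp add: permutes_id finite_permutations)
  finally show ?thesis by auto
qed

lemma lookup_sum_monomials:
  assumes "finite A"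
  shows "Poly_Mapping.lookup (\<Sum>p\<in>A. Poly_Mapping.single (exponent N (f p)) (1::int)) (exponent N \<alpha>) =
    int (card {p \<in> A. \<forall>i<N. f p i = \<alpha> i})"
proof -
  have "Poly_Mapping.lookup (\<Sum>p\<in>A. Poly_Mapping.single (exponent N (f p)) (1::int)) (exponent N \<alpha>) =
      (\<Sum>p\<in>A. if \<forall>i<N. f p i = \<alpha> i then 1 else 0)"
    unfolding Poly_Mapping.lookup_sum lookup_single when_def exponent_eq_iff ..
  also have "\<dots> = int (card {p \<in> A. \<forall>i<N. f p i = \<alpha> i})"
    using assms by (simp add: sum.If_cases Int_def)
  finally show ?thesis .
qed

text \<open>Both cardinalities are the coefficient of the monomial \<alpha> in the product of two
  Schur polynomials, expanded directly and by \<open>schur_poly_mult\<close>.\<close>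

lemma card_pattern_pairs:
  assumes mu: "\<And>k. \<mu> (Suc k) \<le> \<mu> k" "\<And>k. N \<le> k \<Longrightarrow> \<mu> k = 0"
  shows "card {p \<in> patterns N (\<lambda>_. 0) \<mu> \<times> patterns N (\<lambda>_. 0) \<nu>.
      \<forall>i<N. pattern_weight N (fst p) i + pattern_weight N (snd p) i = \<alpha> i} =
    card {p \<in> (SIGMA g:{g \<in> patterns N (\<lambda>_. 0) \<nu>. dominant \<mu> g}.
        patterns N (\<lambda>_. 0) (\<lambda>k. \<mu> k + pattern_weight N g k)). \<forall>i<N. pattern_weight N (snd p) i = \<alpha> i}"
proof -
  let ?P = "patterns N (\<lambda>_. 0)" and ?w = "pattern_weight N" and ?M = "\<lambda>e. Poly_Mapping.single (exponent N e) (1::int)"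
  let ?D = "{g \<in> ?P \<nu>. dominant \<mu> g}"
  let ?S = "SIGMA g:?D. ?P (\<lambda>k. \<mu> k + ?w g k)"
  note fin = finite_patterns_straight
  have schur: "schur_poly N indet \<kappa> = (\<Sum>b\<in>?P \<kappa>. ?M (?w b))" for \<kappa>
    by (simp add: schur_poly_def prod_indet)
  have ex: "exponent N e + exponent N e' = exponent N (\<lambda>i. e i + e' i)" for e e'
    by (simp add: poly_mapping_eq_iff fun_eq_iff lookup_add lookup_exponent)
  have "(\<Sum>(b, g)\<in>?P \<mu> \<times> ?P \<nu>. ?M (\<lambda>i. ?w b i + ?w g i)) = schur_poly N indet \<mu> * schur_poly N indet \<nu>"
    by (simp add: schur sum_product sum.cartesian_product mult_single ex)
  also have "\<dots> = (\<Sum>g\<in>?D. \<Sum>b\<in>?P (\<lambda>k. \<mu> k + ?w g k). ?M (?w b))"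
    using schur_poly_mult[where \<mu> = \<mu> and N = N and \<nu> = \<nu>, OF mu alternant_indet_nonzero]
    by (simp add: schur)
  also have "\<dots> = (\<Sum>(g, b)\<in>?S. ?M (?w b))"
    by (rule sum.Sigma) (auto simp: fin)
  finally have "Poly_Mapping.lookup (\<Sum>p\<in>?P \<mu> \<times> ?P \<nu>. ?M (\<lambda>i. ?w (fst p) i + ?w (snd p) i)) (exponent N \<alpha>) =
      Poly_Mapping.lookup (\<Sum>p\<in>?S. ?M (?w (snd p))) (exponent N \<alpha>)"
    by (simp add: case_prod_unfold)
  moreover have "finite ?S" by (intro finite_SigmaI) (auto simp: fin)
  ultimately show ?thesis
    by (subst (asm) (1 2) lookup_sum_monomials) (auto simp: fin)
qed

subsection \<open>Tableaux as patterns\<close>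

lemma sum_telescope_nat:
  fixes f :: "nat \<Rightarrow> nat"
  assumes "\<And>i. f i \<le> f (Suc i)"
  shows "(\<Sum>i<n. f (Suc i) - f i) = f n - f 0" "f 0 \<le> f n"
proof -
  have "(\<Sum>i<n. f (Suc i) - f i) + f 0 = f n"
  proof (induction n)
    case (Suc n)
    then show ?case using assms[of n] by simp
  qed simp
  then show "(\<Sum>i<n. f (Suc i) - f i) = f n - f 0" "f 0 \<le> f n" by linarith+
qed

lemma partition_antimono:
  assumes "is_partition lam" "1 \<le> i" "i \<le> j"
  shows "lam j \<le> lam i"
  using assms(3)
proof (induction j rule: dec_induct)
  case (step n)
  then have "lam (Suc n) \<le> lam n" using assms(1,2) by (simp add: is_partition_def)
  with step.IH show ?case by simp
qed simp

lemma partition_support: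
  assumes "is_partition lam"
  shows "{i. lam i \<noteq> 0} = {1..plength lam}"
proof -
  let ?S = "{i. lam i \<noteq> 0}"
  have fin: "finite ?S" and z: "lam 0 = 0" using assms by (auto simp: is_partition_def)
  have "?S = {1..Max ?S}" if "?S \<noteq> {}"
  proof (intro equalityI subsetI)
    fix i assume "i \<in> ?S"
    then show "i \<in> {1..Max ?S}" using Max_ge[OF fin] z by (cases i) auto
  next
    fix i assume i: "i \<in> {1..Max ?S}"
    have "Max ?S \<in> ?S" using Max_in[OF fin that] .
    then show "i \<in> ?S" using partition_antimono[OF assms, of i "Max ?S"] i by simp
  qed
  then show ?thesis
    by (cases "?S = {}") (simp_all add: plength_def, metis card_atLeastAtMost diff_Suc_1 One_nat_def)
qed

lemma diagram_partition:
  assumes "is_partition lam"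
  shows "diagram lam = {(i, j). 1 \<le> i \<and> 1 \<le> j \<and> j \<le> lam i}"
  using partition_support[OF assms] by (auto simp: diagram_def)

lemma finite_diagram: "finite (diagram lam)"
proof -
  have "diagram lam \<subseteq> (SIGMA i:{1..plength lam}. {1..lam i})" by (auto simp: diagram_def)
  then show ?thesis by (rule finite_subset) auto
qed

lemma partition_ge_weight_zero:
  assumes "is_partition lam" "weight lam < i"
  shows "lam i = 0"
proof (rule ccontr)
  assume "lam i \<noteq> 0"
  then have "i \<le> plength lam" using partition_support[OF assms(1)] by auto
  also have "plength lam = (\<Sum>i\<in>{1..plength lam}. 1)" by simp
  also have "\<dots> \<le> weight lam"
    unfolding weight_def partition_support[OF assms(1)]
  proof (rule sum_mono)
    fix i assume "i \<in> {1..plength lam}"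
    then have "lam i \<noteq> 0" using partition_support[OF assms(1)] by blast
    then show "1 \<le> lam i" by simp
  qed
  finally show False using assms(2) by simp
qed

lemma weight_eq_sum:
  assumes "is_partition lam" "\<And>i. N < i \<Longrightarrow> lam i = 0"
  shows "weight lam = (\<Sum>i<N. lam (Suc i))"
proof -
  have "{i. lam i \<noteq> 0} \<subseteq> {1..N}"
    using partition_support[OF assms(1)] assms(2) by force
  then have "weight lam = (\<Sum>i=1..N. lam i)"
    unfolding weight_def by (intro sum.mono_neutral_left) auto
  also have "\<dots> = (\<Sum>i<N. lam (Suc i))"
    by (simp add: sum.atLeast1_atMost_eq)
  finally show ?thesis .
qed

lemma skew_diagram_eq:
  assumes "is_skew lam \<mu>"
  shows "skew_diagram lam \<mu> = {(i, j). 1 \<le> i \<and> \<mu> i < j \<and> j \<le> lam i}"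
proof -
  have "is_partition lam" "is_partition \<mu>" using assms by (auto simp: is_skew_def)
  then show ?thesis by (auto simp: skew_diagram_def diagram_partition)
qed

lemma is_skew_empty:
  assumes "is_partition lam"
  shows "is_skew lam (\<lambda>_. 0)" "skew_diagram lam (\<lambda>_. 0) = diagram lam" "SSYT lam = skew_SSYT lam (\<lambda>_. 0)"
proof -
  show "is_skew lam (\<lambda>_. 0)" using assms by (simp add: is_skew_def is_partition_def)
  show "skew_diagram lam (\<lambda>_. 0) = diagram lam" by (auto simp: skew_diagram_def diagram_def)
  then show "SSYT lam = skew_SSYT lam (\<lambda>_. 0)" by (simp add: SSYT_def skew_SSYT_def fillings_def)
qed

definition tableau_pattern :: "(nat \<Rightarrow> nat) \<Rightarrow> (nat \<Rightarrow> nat) \<Rightarrow> (nat \<times> nat \<Rightarrow> nat) \<Rightarrow> nat \<Rightarrow> nat \<Rightarrow> nat" where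
  "tableau_pattern lam \<mu> T i k =
     \<mu> (Suc i) + card {j \<in> {\<mu> (Suc i)<..lam (Suc i)}. T (Suc i, j) \<le> k}"

text \<open>The entry of a box is the first step at which the growing shape contains it;
  \<open>fst p - 1\<close> passes from rows counted from 1 to rows counted from 0.\<close>

definition pattern_tableau :: "(nat \<Rightarrow> nat) \<Rightarrow> (nat \<Rightarrow> nat) \<Rightarrow> (nat \<Rightarrow> nat \<Rightarrow> nat) \<Rightarrow> nat \<times> nat \<Rightarrow> nat" where
  "pattern_tableau lam \<mu> b = (\<lambda>p\<in>skew_diagram lam \<mu>. LEAST k. snd p \<le> b (fst p - 1) k)"

lemma downward_closed_interval:
  fixes A :: "nat set"
  assumes "A \<subseteq> {a<..b}" "\<And>x y. x \<in> A \<Longrightarrow> a < y \<Longrightarrow> y \<le> x \<Longrightarrow> y \<in> A"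
  shows "A = {a<..a + card A}"
proof (cases "A = {}")
  case False
  have fin: "finite A" using assms(1) by (rule finite_subset) simp
  have M: "Max A \<in> A" using Max_in[OF fin False] .
  then have A: "A = {a<..Max A}" using assms Max_ge[OF fin] by fastforce
  then have "card A = Max A - a" by (metis card_greaterThanAtMost)
  then have "a + card A = Max A" using M assms(1) by auto
  then show ?thesis using A by metis
qed simp

context
  fixes lam \<mu> :: "nat \<Rightarrow> nat"
  assumes skew: "is_skew lam \<mu>"
begin

lemma skew_parts:
  "\<mu> i \<le> lam i" "1 \<le> i \<Longrightarrow> i \<le> j \<Longrightarrow> \<mu> j \<le> \<mu> i" "1 \<le> i \<Longrightarrow> i \<le> j \<Longrightarrow> lam j \<le> lam i"
  using skew partition_antimono by (auto simp: is_skew_def)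

lemma skew_diagramE:
  assumes "p \<in> skew_diagram lam \<mu>"
  obtains i j where "p = (Suc i, j)" "\<mu> (Suc i) < j" "j \<le> lam (Suc i)"
proof -
  obtain i j where p: "p = (i, j)" by (cases p)
  moreover obtain i' where "i = Suc i'"
    using assms p by (cases i) (auto simp: skew_diagram_eq[OF skew])
  ultimately show ?thesis using that assms by (simp add: skew_diagram_eq[OF skew])
qed

text \<open>Rows increase weakly, so the entries at most \<open>k\<close> fill an initial segment of
  the row, and the pattern records where it ends.\<close>

lemma le_tableau_pattern_iff:
  assumes T: "semistandard (skew_diagram lam \<mu>) T" and j: "\<mu> (Suc i) < j" "j \<le> lam (Suc i)"
  shows "T (Suc i, j) \<le> k \<longleftrightarrow> j \<le> tableau_pattern lam \<mu> T i k"
proof -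
  let ?A = "{j \<in> {\<mu> (Suc i)<..lam (Suc i)}. T (Suc i, j) \<le> k}"
  have mono: "T (Suc i, y) \<le> T (Suc i, x)" if "\<mu> (Suc i) < y" "y \<le> x" "x \<le> lam (Suc i)" for x y
  proof (cases "y = x")
    case False
    then show ?thesis using that T[unfolded semistandard_def] skew_diagram_eq[OF skew] by force
  qed simp
  have "?A = {\<mu> (Suc i)<..\<mu> (Suc i) + card ?A}"
    by (rule downward_closed_interval[of _ _ "lam (Suc i)"]) (use mono order_trans in fastforce)+
  then have "j \<in> ?A \<longleftrightarrow> j \<in> {\<mu> (Suc i)<..\<mu> (Suc i) + card ?A}" by (rule arg_cong)
  then show ?thesis using j by (simp add: tableau_pattern_def)
qed

lemma tableau_pattern_bounds:
  "\<mu> (Suc i) \<le> tableau_pattern lam \<mu> T i k" "tableau_pattern lam \<mu> T i k \<le> lam (Suc i)"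
proof -
  have "card {j \<in> {\<mu> (Suc i)<..lam (Suc i)}. T (Suc i, j) \<le> k} \<le> card {\<mu> (Suc i)<..lam (Suc i)}"
    by (rule card_mono) auto
  then show "tableau_pattern lam \<mu> T i k \<le> lam (Suc i)"
    using skew_parts(1)[of "Suc i"] by (simp add: tableau_pattern_def)
qed (simp add: tableau_pattern_def)

lemma tableau_pattern_in_patterns:
  assumes T: "T \<in> skew_SSYT lam \<mu>" "\<And>p. p \<in> skew_diagram lam \<mu> \<Longrightarrow> T p \<le> N"
  shows "tableau_pattern lam \<mu> T \<in> patterns N (\<lambda>i. \<mu> (Suc i)) (\<lambda>i. lam (Suc i))"
proof -
  let ?b = "tableau_pattern lam \<mu> T"
  note D = skew_diagram_eq[OF skew]
  have pos: "T (Suc i, j) \<noteq> 0" if "\<mu> (Suc i) < j" "j \<le> lam (Suc i)" for i j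
  proof -
    have "T (Suc i, j) \<in> {1..}" using T(1) that by (intro PiE_mem[of T "skew_diagram lam \<mu>"]) (auto simp: skew_SSYT_def D)
    then show ?thesis by simp
  qed
  have ss: "semistandard (skew_diagram lam \<mu>) T" using T(1) by (simp add: skew_SSYT_def)
  have "{j \<in> {\<mu> (Suc i)<..lam (Suc i)}. T (Suc i, j) \<le> 0} = {}" for i
    using pos[of i] by auto
  then have "?b i 0 = \<mu> (Suc i)" for i by (simp add: tableau_pattern_def)
  moreover have "?b i k = lam (Suc i)" if "N \<le> k" for i k
  proof -
    have "{j \<in> {\<mu> (Suc i)<..lam (Suc i)}. T (Suc i, j) \<le> k} = {\<mu> (Suc i)<..lam (Suc i)}"
      using T(2) that by (fastforce simp: D)
    then show ?thesis using skew_parts(1)[of "Suc i"] by (simp add: tableau_pattern_def)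
  qed
  moreover have "?b i k \<le> ?b i (Suc k)" for i k
    unfolding tableau_pattern_def by (intro add_left_mono card_mono) auto
  \<comment> \<open>The last box in the next row with an entry at most \<open>k + 1\<close> lies
    below the inner shape, or below a box of the skew diagram whose entry is smaller.\<close>
  moreover have "?b (Suc i) (Suc k) \<le> ?b i k" for i k
  proof (cases "?b (Suc i) (Suc k) \<le> \<mu> (Suc i)")
    case True
    then show ?thesis using tableau_pattern_bounds(1)[of i T k] by simp
  next
    case False
    define j where "j = ?b (Suc i) (Suc k)"
    have j: "\<mu> (Suc i) < j" "\<mu> (Suc (Suc i)) < j" "j \<le> lam (Suc (Suc i))" "j \<le> lam (Suc i)"
      using False tableau_pattern_bounds(2)[of T "Suc i" "Suc k"] skew_parts(2,3)[of "Suc i" "Suc (Suc i)"]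
      unfolding j_def by linarith+
    have "T (Suc (Suc i), j) \<le> Suc k"
      using le_tableau_pattern_iff[OF ss j(2,3), of "Suc k"] by (simp add: j_def)
    moreover have "T (Suc i, j) < T (Suc (Suc i), j)"
      using ss j unfolding semistandard_def by (auto simp: D)
    ultimately have "j \<le> ?b i k" using le_tableau_pattern_iff[OF ss j(1,4), of k] by simp
    then show ?thesis by (simp add: j_def)
  qed
  ultimately show ?thesis by (simp add: patterns_def)
qed

context
  fixes b :: "nat \<Rightarrow> nat \<Rightarrow> nat" and N :: nat
  assumes b: "b \<in> patterns N (\<lambda>i. \<mu> (Suc i)) (\<lambda>i. lam (Suc i))"
begin

lemma pattern_tableau_le_iff:
  assumes j: "\<mu> (Suc i) < j" "j \<le> lam (Suc i)"
  shows "pattern_tableau lam \<mu> b (Suc i, j) \<le> k \<longleftrightarrow> j \<le> b i k"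
proof -
  have "j \<le> b i N" using patternsD(2)[OF b, of N i] j by simp
  then have L: "j \<le> b i (LEAST k. j \<le> b i k)" by (rule LeastI)
  have "(LEAST k. j \<le> b i k) \<le> k \<longleftrightarrow> j \<le> b i k"
    using L patterns_mono[OF b] Least_le[of "\<lambda>k. j \<le> b i k"] le_trans by blast
  then show ?thesis using j by (simp add: pattern_tableau_def skew_diagram_eq[OF skew])
qed

lemma pattern_tableau_in_skew_SSYT:
  shows "pattern_tableau lam \<mu> b \<in> skew_SSYT lam \<mu>"
    and "p \<in> skew_diagram lam \<mu> \<Longrightarrow> pattern_tableau lam \<mu> b p \<le> N"
proof -
  let ?T = "pattern_tableau lam \<mu> b"
  note D = skew_diagram_eq[OF skew]
  have pos: "1 \<le> ?T p" and le: "?T p \<le> N" if p: "p \<in> skew_diagram lam \<mu>" for p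
  proof -
    obtain i j where ij: "p = (Suc i, j)" "\<mu> (Suc i) < j" "j \<le> lam (Suc i)"
      using p by (rule skew_diagramE)
    have "\<not> j \<le> b i 0" "j \<le> b i N" using patternsD(1,2)[OF b] ij by simp_all
    then have "\<not> ?T p \<le> 0" "?T p \<le> N"
      using pattern_tableau_le_iff[OF ij(2,3)] ij(1) by blast+
    then show "1 \<le> ?T p" "?T p \<le> N" by linarith+
  qed
  have row: "?T (i, j) \<le> ?T (i, j')" if p: "(i, j) \<in> skew_diagram lam \<mu>" "(i, j') \<in> skew_diagram lam \<mu>" "j < j'" for i j j'
  proof -
    obtain m where i: "i = Suc m" using p by (cases i) (auto simp: D)
    have "j' \<le> b m (?T (i, j'))"
      using pattern_tableau_le_iff[of m j' "?T (i, j')"] p i by (simp add: D)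
    then have "j \<le> b m (?T (i, j'))" using p by simp
    then show ?thesis using pattern_tableau_le_iff[of m j "?T (i, j')"] p i by (simp add: D)
  qed
  have col1: "?T (Suc m, j) < ?T (Suc (Suc m), j)"
    if p: "(Suc m, j) \<in> skew_diagram lam \<mu>" "(Suc (Suc m), j) \<in> skew_diagram lam \<mu>" for m j
  proof -
    obtain k where k: "?T (Suc (Suc m), j) = Suc k" using pos[OF p(2)] by (cases "?T (Suc (Suc m), j)") auto
    have "j \<le> b (Suc m) (Suc k)"
      using pattern_tableau_le_iff[of "Suc m" j "Suc k"] p k by (simp add: D)
    then have "j \<le> b m k" using patternsD(4)[OF b, of m k] by simp
    then show ?thesis using pattern_tableau_le_iff[of m j k] p k by (simp add: D)
  qed
  have col: "?T (i, j) < ?T (i', j)" if p: "(i, j) \<in> skew_diagram lam \<mu>" "(i', j) \<in> skew_diagram lam \<mu>" "i < i'" for i i' j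
  proof -
    have "Suc i \<le> i'" using p by simp
    then show ?thesis using p(2)
    proof (induction i' rule: dec_induct)
      case base
      then show ?case using col1[of "i - 1" j] p(1) by (cases i) (auto simp: D)
    next
      case (step n)
      \<comment> \<open>Columns of a skew diagram have no gaps, so strictness for adjacent rows
        suffices.\<close>
      have n: "(n, j) \<in> skew_diagram lam \<mu>"
        using step.hyps step.prems p(1) skew_parts(2)[of i n] skew_parts(3)[of n "Suc n"] by (auto simp: D)
      then show ?case using step col1[of "n - 1" j] by (cases n) auto
    qed
  qed
  show "?T \<in> skew_SSYT lam \<mu>"
    using pos row col by (auto simp: skew_SSYT_def semistandard_def pattern_tableau_def)
  show "p \<in> skew_diagram lam \<mu> \<Longrightarrow> ?T p \<le> N" by (rule le)
qed

lemma tableau_pattern_pattern_tableau: "tableau_pattern lam \<mu> (pattern_tableau lam \<mu> b) = b"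
proof (intro ext)
  fix i k
  have "{j \<in> {\<mu> (Suc i)<..lam (Suc i)}. pattern_tableau lam \<mu> b (Suc i, j) \<le> k} = {\<mu> (Suc i)<..b i k}"
    using patterns_le[OF b, of i k] pattern_tableau_le_iff[of i _ k] by auto
  then show "tableau_pattern lam \<mu> (pattern_tableau lam \<mu> b) i k = b i k"
    using patterns_mono[OF b, of 0 k i] patternsD(1)[OF b, of i] by (simp add: tableau_pattern_def)
qed

end

lemma pattern_tableau_tableau_pattern:
  assumes T: "T \<in> skew_SSYT lam \<mu>"
  shows "pattern_tableau lam \<mu> (tableau_pattern lam \<mu> T) = T"
proof
  fix p
  have ss: "semistandard (skew_diagram lam \<mu>) T" and ext: "T \<in> extensional (skew_diagram lam \<mu>)"
    using T by (auto simp: skew_SSYT_def PiE_def)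
  show "pattern_tableau lam \<mu> (tableau_pattern lam \<mu> T) p = T p"
  proof (cases "p \<in> skew_diagram lam \<mu>")
    case True
    then obtain i j where ij: "p = (Suc i, j)" "\<mu> (Suc i) < j" "j \<le> lam (Suc i)"
      by (rule skew_diagramE)
    have "(LEAST k. j \<le> tableau_pattern lam \<mu> T i k) = (LEAST k. T p \<le> k)"
      using le_tableau_pattern_iff[OF ss ij(2,3)] ij(1) by simp
    also have "\<dots> = T p" by (rule Least_equality) auto
    finally show ?thesis using True ij(1) by (simp add: pattern_tableau_def)
  next
    case False
    then show ?thesis using extensional_arb[OF ext] by (simp add: pattern_tableau_def)
  qed
qed

lemma bij_betw_tableau_pattern:
  "bij_betw (tableau_pattern lam \<mu>) {T \<in> skew_SSYT lam \<mu>. \<forall>p\<in>skew_diagram lam \<mu>. T p \<le> N}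
    (patterns N (\<lambda>i. \<mu> (Suc i)) (\<lambda>i. lam (Suc i)))"
  by (rule bij_betwI[of _ _ _ "pattern_tableau lam \<mu>"])
    (auto simp: tableau_pattern_in_patterns pattern_tableau_in_skew_SSYT
      tableau_pattern_pattern_tableau pattern_tableau_tableau_pattern)

lemma tableau_pattern_diff:
  "tableau_pattern lam \<mu> T i (Suc k) - tableau_pattern lam \<mu> T i k =
    card {j \<in> {\<mu> (Suc i)<..lam (Suc i)}. T (Suc i, j) = Suc k}"
proof -
  let ?R = "\<lambda>P. {j \<in> {\<mu> (Suc i)<..lam (Suc i)}. P (T (Suc i, j))}"
  have eq: "?R (\<lambda>t. t \<le> Suc k) = ?R (\<lambda>t. t \<le> k) \<union> ?R (\<lambda>t. t = Suc k)" by auto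
  have "card (?R (\<lambda>t. t \<le> Suc k)) = card (?R (\<lambda>t. t \<le> k)) + card (?R (\<lambda>t. t = Suc k))"
    unfolding eq by (rule card_Un_disjoint) auto
  then show ?thesis unfolding tableau_pattern_def by linarith
qed

lemma tableau_pattern_weight:
  assumes N: "\<And>i. N < i \<Longrightarrow> lam i = 0"
  shows "pattern_weight N (tableau_pattern lam \<mu> T) k = card {p \<in> skew_diagram lam \<mu>. T p = Suc k}"
proof -
  let ?S = "SIGMA i:{..<N}. {j \<in> {\<mu> (Suc i)<..lam (Suc i)}. T (Suc i, j) = Suc k}"
  have "{p \<in> skew_diagram lam \<mu>. T p = Suc k} = (\<lambda>(i, j). (Suc i, j)) ` ?S" (is "?L = ?R")
  proof (intro equalityI subsetI)
    fix p assume p: "p \<in> ?L"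
    then obtain i j where ij: "p = (Suc i, j)" "\<mu> (Suc i) < j" "j \<le> lam (Suc i)"
      using skew_diagramE[of p] by blast
    have "i < N" using N[of "Suc i"] ij by (cases "i < N") auto
    then have "(i, j) \<in> ?S" using p ij by auto
    then show "p \<in> ?R" using ij(1) by (intro image_eqI[of _ _ "(i, j)"]) auto
  qed (auto simp: skew_diagram_eq[OF skew])
  moreover have "inj_on (\<lambda>(i, j). (Suc i, j)) ?S" by (auto simp: inj_on_def)
  ultimately have "card ?L = card ?S" by (simp add: card_image)
  also have "\<dots> = pattern_weight N (tableau_pattern lam \<mu> T) k"
    by (simp add: pattern_weight_def tableau_pattern_diff)
  finally show ?thesis by simp
qed

end

section \<open>Companion tableaux\<close>

text \<open>
  If \<open>b\<close> is the pattern of a Littlewood-Richardson tableau, then \<open>transposed b\<close> is the pattern of its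
  companion tableau, whose row \<open>k\<close> lists the rows containing the letter \<open>k\<close>. Column strictness of
  either tableau corresponds to the lattice condition for the other one.
\<close>

definition transposed :: "(nat \<Rightarrow> nat \<Rightarrow> nat) \<Rightarrow> nat \<Rightarrow> nat \<Rightarrow> nat" where
  "transposed b k m = (\<Sum>i<m. b i (Suc k) - b i k)"

text \<open>Column \<open>k\<close> is \<mu> enlarged by the content of the first \<open>k\<close>
  rows of \<open>g\<close>, that is, the shape reached after reading these rows.\<close>

definition untransposed :: "(nat \<Rightarrow> nat) \<Rightarrow> (nat \<Rightarrow> nat \<Rightarrow> nat) \<Rightarrow> nat \<Rightarrow> nat \<Rightarrow> nat" where
  "untransposed \<mu> g i k = \<mu> i + (\<Sum>k'<k. g k' (Suc i) - g k' i)"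

lemma transposed_Suc: "transposed b k (Suc m) - transposed b k m = b m (Suc k) - b m k"
  by (simp add: transposed_def)

lemma untransposed_Suc: "untransposed \<mu> g i (Suc k) - untransposed \<mu> g i k = g k (Suc i) - g k i"
  by (simp add: untransposed_def)

text \<open>\<open>transposed b k m\<close> counts the letters \<open>k\<close> in the first
  \<open>m\<close> rows of \<open>b\<close>. In this form the lattice condition is literally the
  interlacing condition on \<open>transposed b\<close>.\<close>

definition lattice_pattern :: "(nat \<Rightarrow> nat \<Rightarrow> nat) \<Rightarrow> bool" where
  "lattice_pattern b \<longleftrightarrow> (\<forall>k m. transposed b (Suc k) (Suc m) \<le> transposed b k m)"

lemma untransposed_transposed:
  assumes "b \<in> patterns N \<mu> \<beta>"
  shows "untransposed \<mu> (transposed b) = b"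
proof (intro ext)
  fix i k
  have "untransposed \<mu> (transposed b) i k = \<mu> i + (b i k - b i 0)"
    unfolding untransposed_def transposed_Suc by (simp add: sum_telescope_nat patternsD(3)[OF assms])
  then show "untransposed \<mu> (transposed b) i k = b i k"
    using patternsD(1)[OF assms, of i] patterns_mono[OF assms, of 0 k i] by simp
qed

lemma transposed_untransposed:
  assumes "g \<in> patterns N (\<lambda>_. 0) \<nu>"
  shows "transposed (untransposed \<mu> g) = g"
proof (intro ext)
  fix k m
  have "transposed (untransposed \<mu> g) k m = g k m - g k 0"
    unfolding transposed_def untransposed_Suc by (simp add: sum_telescope_nat patternsD(3)[OF assms])
  then show "transposed (untransposed \<mu> g) k m = g k m"
    using patternsD(1)[OF assms, of k] by simp
qed

lemma excess_untransposed:
  assumes "\<And>k i. g k i \<le> g k (Suc i)"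
  shows "excess \<mu> g k i = int (untransposed \<mu> g i k) - int (untransposed \<mu> g (Suc i) k)"
  by (simp add: excess_def untransposed_def of_nat_diff assms flip: sum_subtractf)
    (intro sum.cong, auto)

text \<open>The excess is the difference of neighbouring parts of the current shape, so a violation
  is exactly a failure of interlacing between successive shapes.\<close>

lemma dominant_iff_untransposed:
  assumes "\<And>k i. g k i \<le> g k (Suc i)"
  shows "dominant \<mu> g \<longleftrightarrow> (\<forall>i k. untransposed \<mu> g (Suc i) (Suc k) \<le> untransposed \<mu> g i k)"
proof -
  have "violates \<mu> g k i \<longleftrightarrow> untransposed \<mu> g i k < untransposed \<mu> g (Suc i) (Suc k)" for i k
  proof -
    have "untransposed \<mu> g (Suc i) (Suc k) = untransposed \<mu> g (Suc i) k + (g k (Suc (Suc i)) - g k (Suc i))"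
      by (simp add: untransposed_def)
    then show ?thesis
      using assms[of k "Suc i"]
      unfolding violates_def excess_untransposed[where g = g, OF assms] by linarith
  qed
  then show ?thesis by (auto simp: dominant_def not_less)
qed

text \<open>The conditions are exchanged in pairs: outer shape with content, and interlacing of one
  pattern with the lattice condition or dominance of the other.\<close>

lemma bij_betw_transposed:
  assumes nu: "\<And>k. N \<le> k \<Longrightarrow> \<nu> k = 0" "\<And>k. \<nu> (Suc k) \<le> \<nu> k"
    and la: "\<And>k. N \<le> k \<Longrightarrow> \<beta> k = 0" "\<And>k. \<mu> k \<le> \<beta> k"
  shows "bij_betw transposed
    {b \<in> patterns N \<mu> \<beta>. lattice_pattern b \<and> (\<forall>k. pattern_weight N b k = \<nu> k)}
    {g \<in> patterns N (\<lambda>_. 0) \<nu>. dominant \<mu> g \<and> (\<forall>i. \<mu> i + pattern_weight N g i = \<beta> i)}"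
    (is "bij_betw _ ?B ?G")
proof (rule bij_betwI[of _ _ _ "untransposed \<mu>"])
  show "transposed \<in> ?B \<rightarrow> ?G"
  proof
    fix b assume "b \<in> ?B"
    then have b: "b \<in> patterns N \<mu> \<beta>" and lat: "lattice_pattern b" and wt: "\<And>k. pattern_weight N b k = \<nu> k"
      by auto
    let ?g = "transposed b"
    have mono: "?g k m \<le> ?g k (Suc m)" for k m by (simp add: transposed_def)
    have const: "?g k m = \<nu> k" if "N \<le> m" for k m
    proof -
      have "b i k = 0" if "N \<le> i" for i k using patterns_le[OF b, of i k] la(1)[OF that] by simp
      then have "?g k m = (\<Sum>i<N. b i (Suc k) - b i k)"
        unfolding transposed_def using that by (intro sum.mono_neutral_right) auto
      then show ?thesis using wt[of k] by (simp add: pattern_weight_def)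
    qed
    have "?g \<in> patterns N (\<lambda>_. 0) \<nu>"
      using mono const lat by (simp add: patterns_def lattice_pattern_def transposed_def[of _ _ 0])
    moreover have "dominant \<mu> ?g"
      using patternsD(4)[OF b] by (simp add: dominant_iff_untransposed mono untransposed_transposed[OF b])
    moreover have "\<mu> i + pattern_weight N ?g i = \<beta> i" for i
      using patternsD(1)[OF b, of i] patternsD(2)[OF b, of N i] la(2)[of i]
      unfolding pattern_weight_def transposed_Suc by (simp add: sum_telescope_nat patternsD(3)[OF b])
    ultimately show "?g \<in> ?G" by simp
  qed
  show "untransposed \<mu> \<in> ?G \<rightarrow> ?B"
  proof
    fix g assume "g \<in> ?G"
    then have g: "g \<in> patterns N (\<lambda>_. 0) \<nu>" and dom: "dominant \<mu> g"
      and wt: "\<And>i. \<mu> i + pattern_weight N g i = \<beta> i"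
      by auto
    let ?b = "untransposed \<mu> g"
    have mono: "?b i k \<le> ?b i (Suc k)" for i k by (simp add: untransposed_def)
    have "?b i k = \<beta> i" if "N \<le> k" for i k
    proof -
      have "(\<Sum>k'<k. g k' (Suc i) - g k' i) = (\<Sum>k'<N. g k' (Suc i) - g k' i)"
        using patterns_straight_row_zero[OF g] that by (intro sum.mono_neutral_right) auto
      then show ?thesis using wt[of i] by (simp add: pattern_weight_def untransposed_def)
    qed
    then have "?b \<in> patterns N \<mu> \<beta>"
      using mono dom by (simp add: patterns_def dominant_iff_untransposed patternsD(3)[OF g] untransposed_def[of _ _ _ 0])
    moreover have "lattice_pattern ?b"
      using patternsD(4)[OF g] by (simp add: lattice_pattern_def transposed_untransposed[OF g])
    moreover have "pattern_weight N ?b k = \<nu> k" for k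
      using patternsD(1)[OF g, of k] patternsD(2)[OF g, of N k]
      unfolding pattern_weight_def untransposed_Suc by (simp add: sum_telescope_nat patternsD(3)[OF g])
    ultimately show "?b \<in> ?B" by simp
  qed
qed (auto simp: untransposed_transposed transposed_untransposed)

section \<open>Reading words and the lattice condition\<close>

lemma count_list_map_card:
  "count_list (map f [a..<c]) v = card {j \<in> {a..<c}. f j = v}"
proof -
  have "count_list (map f xs) v = length (filter (\<lambda>j. f j = v) xs)" for xs
    by (induction xs) auto
  moreover have "length (filter (\<lambda>j. f j = v) [a..<c]) = card (set (filter (\<lambda>j. f j = v) [a..<c]))"
    by (rule distinct_card[symmetric]) simp
  moreover have "set (filter (\<lambda>j. f j = v) [a..<c]) = {j \<in> {a..<c}. f j = v}" by auto
  ultimately show ?thesis by simp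
qed

text \<open>
  Reading a row from right to left, the lattice condition for \<open>v\<close> and \<open>v + 1\<close> is tightest
  after the last \<open>v + 1\<close>, before any \<open>v\<close> of the same row has been read.
\<close>

lemma lattice_suffixes_sorted_append:
  fixes r w :: "nat list"
  assumes "sorted r"
  shows "(\<forall>j. count_list (drop j (r @ w)) (Suc v) \<le> count_list (drop j (r @ w)) v) \<longleftrightarrow>
    (\<forall>j. count_list (drop j w) (Suc v) \<le> count_list (drop j w) v) \<and>
    count_list r (Suc v) + count_list w (Suc v) \<le> count_list w v" (is "?L \<longleftrightarrow> ?R \<and> ?C")
proof
  assume L: ?L
  have "?R" using L[rule_format, of "length r + _"] by (simp add: drop_append)
  moreover have ?C
  proof -
    let ?n = "length (takeWhile (\<lambda>x. x \<le> v) r)"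
    have "drop ?n (r @ w) = dropWhile (\<lambda>x. x \<le> v) r @ w"
      by (simp add: dropWhile_eq_drop length_takeWhile_le)
    moreover have "count_list (takeWhile (\<lambda>x. x \<le> v) r) (Suc v) = 0"
      by (auto simp: count_list_0_iff dest: set_takeWhileD)
    then have "count_list r (Suc v) = count_list (dropWhile (\<lambda>x. x \<le> v) r) (Suc v)"
      by (metis add_0 count_list_append takeWhile_dropWhile_id)
    moreover have "x > v" if "x \<in> set (dropWhile (\<lambda>x. x \<le> v) r)" for x
      using that \<open>sorted r\<close>
      by (induction r) (auto split: if_splits)
    then have "count_list (dropWhile (\<lambda>x. x \<le> v) r) v = 0"
      by (auto simp: count_list_0_iff)
    ultimately show ?C using L[rule_format, of ?n] by simp
  qed
  ultimately show "?R \<and> ?C" ..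
next
  assume RC: "?R \<and> ?C"
  show ?L
  proof
    fix j
    show "count_list (drop j (r @ w)) (Suc v) \<le> count_list (drop j (r @ w)) v"
    proof (cases "j \<le> length r")
      case True
      have "count_list r (Suc v) = count_list (take j r) (Suc v) + count_list (drop j r) (Suc v)"
        by (metis append_take_drop_id count_list_append)
      then show ?thesis using RC True by simp
    next
      case False
      then show ?thesis using RC by simp
    qed
  qed
qed

lemma all_ge_1_iff: "(\<forall>j\<ge>(1::nat). P j) \<longleftrightarrow> (\<forall>k. P (Suc k))"
  by (auto simp: Suc_le_eq gr0_conv_Suc)

lemma yamanouchi_alt:
  "yamanouchi w \<longleftrightarrow> (\<forall>v. \<forall>j. count_list (drop j w) (Suc (Suc v)) \<le> count_list (drop j w) (Suc v))"
proof -
  have "(\<forall>j<length w. P j) \<longleftrightarrow> (\<forall>j. P j)" if "\<And>j. length w \<le> j \<Longrightarrow> P j" for P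
    using that not_le by blast
  from this[of "\<lambda>j. count_list (drop j w) (Suc i) \<le> count_list (drop j w) i" for i]
  have "yamanouchi w \<longleftrightarrow> (\<forall>i\<ge>1. \<forall>j. count_list (drop j w) (Suc i) \<le> count_list (drop j w) i)"
    by (simp add: yamanouchi_def)
  also have "\<dots> \<longleftrightarrow> (\<forall>v. \<forall>j. count_list (drop j w) (Suc (Suc v)) \<le> count_list (drop j w) (Suc v))"
    by (rule all_ge_1_iff)
  finally show ?thesis .
qed

context
  fixes lam \<mu> :: "nat \<Rightarrow> nat" and T :: "nat \<times> nat \<Rightarrow> nat"
  assumes skew: "is_skew lam \<mu>" and T: "T \<in> skew_SSYT lam \<mu>"
begin

text \<open>The number of rows is arbitrary so that rows can be added one at a time; those beyond
  the length of \<open>lam\<close> contribute nothing.\<close>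

definition rows_word :: "nat \<Rightarrow> nat list" where
  "rows_word n = concat (map (\<lambda>i. map (\<lambda>j. T (i, j)) [Suc (\<mu> i)..<Suc (lam i)]) (rev [1..<Suc n]))"

lemma rows_word_Suc:
  "rows_word (Suc n) = map (\<lambda>j. T (Suc n, j)) [Suc (\<mu> (Suc n))..<Suc (lam (Suc n))] @ rows_word n"
  by (simp add: rows_word_def)

lemma reading_word_rows_word:
  assumes "plength lam \<le> n"
  shows "reading_word lam \<mu> T = rows_word n"
  using assms
proof (induction n rule: dec_induct)
  case base
  then show ?case by (simp add: reading_word_def rows_word_def)
next
  case (step n)
  have "Suc n \<notin> {i. lam i \<noteq> 0}"
    using partition_support[of lam] skew step.hyps by (simp add: is_skew_def)
  then show ?case using step.IH by (simp add: rows_word_Suc)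
qed

lemma count_row:
  "count_list (map (\<lambda>j. T (Suc n, j)) [Suc (\<mu> (Suc n))..<Suc (lam (Suc n))]) (Suc k) =
    tableau_pattern lam \<mu> T n (Suc k) - tableau_pattern lam \<mu> T n k"
  unfolding count_list_map_card tableau_pattern_diff[OF skew]
  by (intro arg_cong[of _ _ card]) auto

lemma count_rows_word: "count_list (rows_word n) (Suc k) = transposed (tableau_pattern lam \<mu> T) k n"
proof (induction n)
  case 0
  then show ?case by (simp add: rows_word_def transposed_def)
next
  case (Suc n)
  then show ?case unfolding rows_word_Suc count_list_append count_row by (simp add: transposed_def)
qed

lemma sorted_row: "sorted (map (\<lambda>j. T (Suc n, j)) [Suc (\<mu> (Suc n))..<Suc (lam (Suc n))])"
proof -
  have "T (Suc n, j) \<le> T (Suc n, j')" if "\<mu> (Suc n) < j" "j < j'" "j' \<le> lam (Suc n)" for j j'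
    using T that by (auto simp: skew_SSYT_def semistandard_def skew_diagram_eq[OF skew])
  then show ?thesis
    unfolding sorted_map by (intro sorted_wrt_mono_rel[OF _ sorted_wrt_upt]) auto
qed

text \<open>A new bottom row is a sorted prefix of the word, and by
  \<open>lattice_suffixes_sorted_append\<close> it adds one inequality for each letter.\<close>

lemma yamanouchi_rows_word:
  "yamanouchi (rows_word n) \<longleftrightarrow>
    (\<forall>k. \<forall>m<n. transposed (tableau_pattern lam \<mu> T) (Suc k) (Suc m) \<le> transposed (tableau_pattern lam \<mu> T) k m)"
proof (induction n)
  case 0
  then show ?case by (simp add: rows_word_def yamanouchi_def)
next
  case (Suc n)
  have "count_list (map (\<lambda>j. T (Suc n, j)) [Suc (\<mu> (Suc n))..<Suc (lam (Suc n))]) (Suc (Suc k)) + count_list (rows_word n) (Suc (Suc k))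
      = transposed (tableau_pattern lam \<mu> T) (Suc k) (Suc n)" for k
    unfolding count_row count_rows_word by (simp add: transposed_def)
  then have "yamanouchi (rows_word (Suc n)) \<longleftrightarrow> yamanouchi (rows_word n) \<and>
      (\<forall>k. transposed (tableau_pattern lam \<mu> T) (Suc k) (Suc n) \<le> transposed (tableau_pattern lam \<mu> T) k n)"
    unfolding yamanouchi_alt rows_word_Suc lattice_suffixes_sorted_append[OF sorted_row] count_rows_word
    by (simp add: all_conj_distrib)
  then show ?case unfolding Suc.IH by (auto simp: less_Suc_eq)
qed

text \<open>The word tests only the rows that exist. From \<open>N\<close> rows on the counts are
  constant, and the inequalities left over say that the content is weakly decreasing, which is
  \<open>wt\<close>.\<close>

lemma yamanouchi_iff_lattice_pattern:
  assumes N: "\<And>i. N < i \<Longrightarrow> lam i = 0" and wt: "\<And>k. pattern_weight N (tableau_pattern lam \<mu> T) (Suc k) \<le> pattern_weight N (tableau_pattern lam \<mu> T) k"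
  shows "yamanouchi (reading_word lam \<mu> T) \<longleftrightarrow> lattice_pattern (tableau_pattern lam \<mu> T)"
proof -
  let ?b = "tableau_pattern lam \<mu> T"
  have "plength lam \<le> N"
  proof (rule ccontr)
    assume "\<not> plength lam \<le> N"
    then have "plength lam \<in> {i. lam i \<noteq> 0}"
      using partition_support[of lam] skew by (simp add: is_skew_def)
    then show False using N \<open>\<not> plength lam \<le> N\<close> by simp
  qed
  moreover have "transposed ?b k m = pattern_weight N ?b k" if "N \<le> m" for k m
  proof -
    have "?b i k = 0" if "N \<le> i" for i k
      using tableau_pattern_bounds(2)[OF skew, of T i k] N[of "Suc i"] that by simp
    then show ?thesis
      unfolding transposed_def pattern_weight_def using that by (intro sum.mono_neutral_right) auto
  qed
  then have "transposed ?b (Suc k) (Suc m) \<le> transposed ?b k m" if "N \<le> m" for k m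
    using that wt by simp
  ultimately show ?thesis
    using yamanouchi_rows_word[of N] reading_word_rows_word[of N] not_less
    unfolding lattice_pattern_def by metis
qed

end

lemma bij_betw_filter:
  assumes "bij_betw f A B" "\<And>x. x \<in> A \<Longrightarrow> P x \<longleftrightarrow> Q (f x)"
  shows "bij_betw f {x \<in> A. P x} {y \<in> B. Q y}"
  using assms by (auto simp: bij_betw_def inj_on_def)

lemma LR_coeff_eq_card_dominant:
  assumes skew: "is_skew lam \<mu>" and nu: "is_partition \<nu>"
    and N: "\<And>i. N < i \<Longrightarrow> lam i = 0" "\<And>i. N < i \<Longrightarrow> \<nu> i = 0"
  shows "LR_coeff \<mu> \<nu> lam = card {g \<in> patterns N (\<lambda>_. 0) (\<lambda>k. \<nu> (Suc k)).
    dominant (\<lambda>k. \<mu> (Suc k)) g \<and> (\<forall>k. \<mu> (Suc k) + pattern_weight N g k = lam (Suc k))}" (is "_ = card ?G")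
proof -
  let ?tp = "tableau_pattern lam \<mu>"
  let ?A = "{T \<in> skew_SSYT lam \<mu>. \<forall>p\<in>skew_diagram lam \<mu>. T p \<le> N}"
  let ?B = "{b \<in> patterns N (\<lambda>k. \<mu> (Suc k)) (\<lambda>k. lam (Suc k)). lattice_pattern b \<and> (\<forall>k. pattern_weight N b k = \<nu> (Suc k))}"
  let ?LR = "{T \<in> skew_SSYT lam \<mu>. yamanouchi (reading_word lam \<mu> T) \<and>
             (\<forall>j\<ge>1. card {p \<in> skew_diagram lam \<mu>. T p = j} = \<nu> j)}"
  have nu_mono: "\<nu> (Suc (Suc k)) \<le> \<nu> (Suc k)" for k using nu by (simp add: is_partition_def)
  have fin: "finite (skew_diagram lam \<mu>)" by (simp add: skew_diagram_def finite_diagram)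
  have content: "(\<forall>j\<ge>1. card {p \<in> skew_diagram lam \<mu>. T p = j} = \<nu> j) \<longleftrightarrow> (\<forall>k. pattern_weight N (?tp T) k = \<nu> (Suc k))" for T
    using all_ge_1_iff[of "\<lambda>j. card {p \<in> skew_diagram lam \<mu>. T p = j} = \<nu> j"]
      tableau_pattern_weight[of lam \<mu> N T] skew N(1) by simp
  have eq: "?LR = {T \<in> ?A. yamanouchi (reading_word lam \<mu> T) \<and> (\<forall>k. pattern_weight N (?tp T) k = \<nu> (Suc k))}"
  proof (intro equalityI subsetI)
    fix T assume T: "T \<in> ?LR"
    \<comment> \<open>A letter \<open>j\<close> beyond \<open>N\<close> would have to occur
      \<open>\<nu> j = 0\<close> times.\<close>
    have "T p \<le> N" if p: "p \<in> skew_diagram lam \<mu>" for p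
    proof (rule ccontr)
      assume "\<not> T p \<le> N"
      then have "card {q \<in> skew_diagram lam \<mu>. T q = T p} = 0" using T N(2)[of "T p"] by auto
      then show False using p fin by (cases p) auto
    qed
    then show "T \<in> {T \<in> ?A. yamanouchi (reading_word lam \<mu> T) \<and> (\<forall>k. pattern_weight N (?tp T) k = \<nu> (Suc k))}"
      using T content[of T] by simp
  next
    fix T assume "T \<in> {T \<in> ?A. yamanouchi (reading_word lam \<mu> T) \<and> (\<forall>k. pattern_weight N (?tp T) k = \<nu> (Suc k))}"
    then show "T \<in> ?LR" using content[of T] by simp
  qed
  have b1: "bij_betw ?tp {T \<in> ?A. yamanouchi (reading_word lam \<mu> T) \<and> (\<forall>k. pattern_weight N (?tp T) k = \<nu> (Suc k))} ?B"
  proof (rule bij_betw_filter[OF bij_betw_tableau_pattern[OF skew]])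
    fix T assume "T \<in> ?A"
    then have T: "T \<in> skew_SSYT lam \<mu>" by simp
    show "yamanouchi (reading_word lam \<mu> T) \<and> (\<forall>k. pattern_weight N (?tp T) k = \<nu> (Suc k)) \<longleftrightarrow>
        lattice_pattern (?tp T) \<and> (\<forall>k. pattern_weight N (?tp T) k = \<nu> (Suc k))"
      using yamanouchi_iff_lattice_pattern[OF skew T, of N] N(1) nu_mono by auto
  qed
  have b2: "bij_betw transposed ?B ?G"
    by (rule bij_betw_transposed) (use N nu_mono skew in \<open>auto simp: is_skew_def\<close>)
  show ?thesis
    unfolding LR_coeff_def eq by (rule trans[OF bij_betw_same_card[OF b1] bij_betw_same_card[OF b2]])
qed

subsection \<open>Counting tableaux by their entries\<close>

text \<open>Bijections between the fibres are chosen and glued. This converts finite counts into a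
  reindexing usable for infinite sums.\<close>

lemma exists_fibre_preserving_bij:
  assumes "\<And>c. finite {x \<in> A. f x = c}" "\<And>c. finite {y \<in> B. g y = c}"
    and "\<And>c. card {x \<in> A. f x = c} = card {y \<in> B. g y = c}"
  obtains h where "bij_betw h A B" "\<And>x. x \<in> A \<Longrightarrow> g (h x) = f x"
proof -
  have "\<forall>c. \<exists>h. bij_betw h {x \<in> A. f x = c} {y \<in> B. g y = c}"
    using assms finite_same_card_bij by blast
  then obtain H where H: "\<And>c. bij_betw (H c) {x \<in> A. f x = c} {y \<in> B. g y = c}" by metis
  define h where "h x = H (f x) x" for x
  have mem: "h x \<in> B" "g (h x) = f x" if "x \<in> A" for x
    using bij_betwE[OF H[of "f x"]] that by (auto simp: h_def)
  have "inj_on h A"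
  proof (rule inj_onI)
    fix x y assume xy: "x \<in> A" "y \<in> A" "h x = h y"
    then have "f x = f y" using mem(2) by metis
    then show "x = y" using bij_betw_imp_inj_on[OF H[of "f x"]] xy by (auto simp: h_def inj_on_def)
  qed
  moreover have "B \<subseteq> h ` A"
  proof
    fix y assume "y \<in> B"
    then have "y \<in> H (g y) ` {x \<in> A. f x = g y}" using bij_betw_imp_surj_on[OF H[of "g y"]] by simp
    then obtain x where "x \<in> A" "f x = g y" "y = H (g y) x" by blast
    then have "y = h x" by (simp add: h_def)
    then show "y \<in> h ` A" using \<open>x \<in> A\<close> by blast
  qed
  ultimately have "bij_betw h A B" using mem(1) by (auto simp: bij_betw_def)
  then show ?thesis using that mem(2) by blast
qed

definition entries :: "(nat \<Rightarrow> nat) \<Rightarrow> (nat \<times> nat \<Rightarrow> nat) \<Rightarrow> nat multiset" where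
  "entries lam M = image_mset M (mset_set (diagram lam))"

lemma set_entries: "set_mset (entries lam M) = M ` diagram lam"
  by (simp add: entries_def finite_diagram)

lemma count_entries:
  assumes "is_partition lam" "\<And>i. N < i \<Longrightarrow> lam i = 0"
  shows "count (entries lam M) (Suc k) = pattern_weight N (tableau_pattern lam (\<lambda>_. 0) M) k"
proof -
  have "count (entries lam M) (Suc k) = card {p \<in> diagram lam. M p = Suc k}"
    by (simp add: entries_def count_image_mset_eq_card_vimage finite_diagram)
  then show ?thesis
    using tableau_pattern_weight[of lam "\<lambda>_. 0" N M k] is_skew_empty[OF assms(1)] assms(2) by simp
qed

lemma SSYT_pos:
  assumes "M \<in> SSYT lam" "p \<in> diagram lam"
  shows "1 \<le> M p"
  using assms PiE_mem[of M "diagram lam" "\<lambda>_. {1..}" p] by (auto simp: SSYT_def fillings_def)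

lemma bij_betw_SSYT_patterns:
  assumes "is_partition lam"
  shows "bij_betw (tableau_pattern lam (\<lambda>_. 0)) {M \<in> SSYT lam. \<forall>p\<in>diagram lam. M p \<le> N}
    (patterns N (\<lambda>_. 0) (\<lambda>i. lam (Suc i)))"
  using bij_betw_tableau_pattern[of lam "\<lambda>_. 0" N] is_skew_empty[OF assms] by simp

lemma multiset_eq_iff_bounded:
  assumes "set_mset A \<subseteq> {1..N}" "set_mset B \<subseteq> {1..N}"
  shows "A = B \<longleftrightarrow> (\<forall>k<N. count A (Suc k) = count B (Suc k))"
proof
  assume *: "\<forall>k<N. count A (Suc k) = count B (Suc k)"
  show "A = B"
  proof (rule multiset_eqI)
    fix x
    show "count A x = count B x"
    proof (cases "x \<in> {1..N}")
      case True
      then show ?thesis using * by (cases x) auto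
    next
      case False
      then show ?thesis using assms by (metis count_eq_zero_iff subsetD)
    qed
  qed
qed simp

lemma LR_shapes_weight:
  assumes "lam \<in> LR_shapes \<mu> \<nu>"
  shows "is_partition lam" "is_skew lam \<mu>" "weight lam = weight \<mu> + weight \<nu>"
proof -
  show skew: "is_skew lam \<mu>" using assms by (simp add: LR_shapes_def)
  then show part: "is_partition lam" by (simp add: is_skew_def)
  have mu: "is_partition \<mu>" using skew by (simp add: is_skew_def)
  define N where "N = max (weight lam) (weight \<mu>)"
  have "weight \<mu> = (\<Sum>i<N. \<mu> (Suc i))" "weight lam = (\<Sum>i<N. lam (Suc i))"
    using part mu by (auto intro!: weight_eq_sum simp: partition_ge_weight_zero N_def)
  \<comment> \<open>Containment of the shapes makes the truncated subtraction in
    \<open>skew_weight\<close> exact.\<close>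
  then have "weight \<mu> \<le> weight lam"
    using skew by (auto simp: is_skew_def intro: sum_mono)
  moreover have "weight lam - weight \<mu> = weight \<nu>"
    using assms by (simp add: LR_shapes_def skew_weight_def)
  ultimately show "weight lam = weight \<mu> + weight \<nu>" by simp
qed

lemma partition_le_weight:
  assumes "is_partition lam"
  shows "lam i \<le> weight lam"
proof (cases "lam i = 0")
  case False
  then show ?thesis
    unfolding weight_def using assms by (intro member_le_sum) (auto simp: is_partition_def)
qed simp

lemma finite_LR_shapes: "finite (LR_shapes \<mu> \<nu>)"
proof -
  let ?n = "weight \<mu> + weight \<nu>"
  have "LR_shapes \<mu> \<nu> \<subseteq> (\<lambda>f i. if i \<le> ?n then f i else 0) ` ({..?n} \<rightarrow>\<^sub>E {..?n})"
  proof
    fix lam assume lam: "lam \<in> LR_shapes \<mu> \<nu>"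
    note part = LR_shapes_weight(1,3)[OF lam]
    have "lam = (\<lambda>i. if i \<le> ?n then restrict lam {..?n} i else 0)"
      using partition_ge_weight_zero[OF part(1)] part(2) by (auto simp: fun_eq_iff)
    moreover have "restrict lam {..?n} \<in> {..?n} \<rightarrow>\<^sub>E {..?n}"
      using partition_le_weight[OF part(1)] part(2) by auto
    ultimately show "lam \<in> (\<lambda>f i. if i \<le> ?n then f i else 0) ` ({..?n} \<rightarrow>\<^sub>E {..?n})" by blast
  qed
  then show ?thesis by (rule finite_subset) (intro finite_imageI finite_PiE, auto)
qed

section \<open>The Littlewood-Richardson rule for tableaux of given content\<close>

text \<open>The shape that the whole content of \<open>g\<close> reaches from \<mu>, indexed from 1
  again, with the value at 0 that \<open>is_partition\<close> prescribes.\<close>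

definition pattern_shape :: "nat \<Rightarrow> (nat \<Rightarrow> nat) \<Rightarrow> (nat \<Rightarrow> nat \<Rightarrow> nat) \<Rightarrow> nat \<Rightarrow> nat" where
  "pattern_shape N \<mu> g i = (case i of 0 \<Rightarrow> 0 | Suc k \<Rightarrow> \<mu> (Suc k) + pattern_weight N g k)"

context
  fixes \<mu> \<nu> :: "nat \<Rightarrow> nat" and N :: nat
  assumes mu: "is_partition \<mu>" and nu: "is_partition \<nu>" and N: "weight \<mu> + weight \<nu> \<le> N"
begin

lemma parts_beyond:
  assumes "N < i"
  shows "\<mu> i = 0" "\<nu> i = 0" "lam \<in> LR_shapes \<mu> \<nu> \<Longrightarrow> lam i = 0"
  using assms N mu nu LR_shapes_weight[of lam \<mu> \<nu>] partition_ge_weight_zero[of \<mu> i]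
    partition_ge_weight_zero[of \<nu> i] partition_ge_weight_zero[of lam i] by auto

lemma pattern_shape_in_LR_shapes:
  assumes g: "g \<in> patterns N (\<lambda>_. 0) (\<lambda>k. \<nu> (Suc k))" and dom: "dominant (\<lambda>k. \<mu> (Suc k)) g"
  shows "pattern_shape N \<mu> g \<in> LR_shapes \<mu> \<nu>"
proof -
  let ?lam = "pattern_shape N \<mu> g"
  have zero: "?lam i = 0" if "N < i" for i
    using that parts_beyond(1)[of i] dominant_shape(2)[OF g dom] by (cases i) (auto simp: pattern_shape_def)
  have "?lam (Suc i) \<le> ?lam i" if "1 \<le> i" for i
    using that dominant_shape(1)[OF g dom] by (cases i) (auto simp: pattern_shape_def)
  moreover have "i \<in> {..N}" if "i \<in> {i. ?lam i \<noteq> 0}" for i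
    using that zero[of i] by (cases "N < i") auto
  then have "{i. ?lam i \<noteq> 0} \<subseteq> {..N}" by (rule subsetI)
  then have "finite {i. ?lam i \<noteq> 0}" by (rule finite_subset) simp
  ultimately have part: "is_partition ?lam"
    by (simp add: is_partition_def pattern_shape_def)
  moreover have "\<mu> i \<le> ?lam i" for i
    using mu by (cases i) (auto simp: pattern_shape_def is_partition_def)
  moreover have "weight ?lam = weight \<mu> + weight \<nu>"
  proof -
    have "(\<Sum>k<N. pattern_weight N g k) = (\<Sum>i<N. \<Sum>k<N. g i (Suc k) - g i k)"
      unfolding pattern_weight_def by (rule sum.swap)
    also have "\<dots> = (\<Sum>i<N. \<nu> (Suc i))"
      by (simp add: sum_telescope_nat patternsD[OF g])
    also have "\<dots> = weight \<nu>"
      using weight_eq_sum[OF nu, of N] parts_beyond(2) by simp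
    finally have "(\<Sum>k<N. pattern_weight N g k) = weight \<nu>" .
    moreover have "weight ?lam = (\<Sum>i<N. ?lam (Suc i))" "weight \<mu> = (\<Sum>i<N. \<mu> (Suc i))"
      using weight_eq_sum[OF part] zero weight_eq_sum[OF mu] parts_beyond(1) by blast+
    ultimately show ?thesis by (simp add: pattern_shape_def sum.distrib)
  qed
  ultimately show ?thesis
    using mu by (simp add: LR_shapes_def is_skew_def skew_weight_def)
qed

lemma LR_coeff_eq_card_shape:
  assumes "lam \<in> LR_shapes \<mu> \<nu>"
  shows "LR_coeff \<mu> \<nu> lam = card {g \<in> {g \<in> patterns N (\<lambda>_. 0) (\<lambda>k. \<nu> (Suc k)). dominant (\<lambda>k. \<mu> (Suc k)) g}.
    pattern_shape N \<mu> g = lam}"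
proof -
  have "lam 0 = 0" using LR_shapes_weight(1)[OF assms] by (simp add: is_partition_def)
  then have "(\<forall>k. \<mu> (Suc k) + pattern_weight N g k = lam (Suc k)) \<longleftrightarrow> pattern_shape N \<mu> g = lam" for g
    by (auto simp: fun_eq_iff pattern_shape_def split: nat.split)
  then show ?thesis
    using LR_coeff_eq_card_dominant[OF LR_shapes_weight(2)[OF assms] nu, of N] parts_beyond(2,3) assms
    by (simp add: conj_assoc)
qed

text \<open>A tableau whose entries form a part of \<alpha> uses letters at most \<open>N\<close>
  only, so it is a pattern and \<open>card_pattern_pairs\<close> applies.\<close>

lemma card_entries_pairs_bounded:
  assumes \<alpha>: "set_mset \<alpha> \<subseteq> {1..N}"
  shows "card {p \<in> SSYT \<mu> \<times> SSYT \<nu>. entries \<mu> (fst p) + entries \<nu> (snd p) = \<alpha>} =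
      (\<Sum>lam\<in>LR_shapes \<mu> \<nu>. LR_coeff \<mu> \<nu> lam * card {M \<in> SSYT lam. entries lam M = \<alpha>})"
    and "finite {p \<in> SSYT \<mu> \<times> SSYT \<nu>. entries \<mu> (fst p) + entries \<nu> (snd p) = \<alpha>}"
    and "lam \<in> LR_shapes \<mu> \<nu> \<Longrightarrow> finite {M \<in> SSYT lam. entries lam M = \<alpha>}"
proof -
  let ?S = "\<lambda>lam. {M \<in> SSYT lam. \<forall>p\<in>diagram lam. M p \<le> N}"
  let ?tp = "\<lambda>lam. tableau_pattern lam (\<lambda>_. 0)"
  let ?a = "\<lambda>k. count \<alpha> (Suc k)"
  let ?P = "patterns N (\<lambda>_. 0)" and ?w = "pattern_weight N"
  let ?\<mu> = "\<lambda>k. \<mu> (Suc k)" and ?\<nu> = "\<lambda>k. \<nu> (Suc k)"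
  have set_S: "set_mset (entries lam M) \<subseteq> {1..N}" if "M \<in> ?S lam" for lam M
    using that SSYT_pos[of M lam] by (auto simp: set_entries)
  have S_I: "M \<in> ?S lam" if "M \<in> SSYT lam" "entries lam M \<subseteq># \<alpha>" for lam M
    using that \<alpha> set_mset_mono[OF that(2)] by (fastforce simp: set_entries)
  have bij: "bij_betw (?tp lam) (?S lam) (?P (\<lambda>i. lam (Suc i)))" if "is_partition lam" for lam
    by (rule bij_betw_SSYT_patterns[OF that])
  have fin_S: "finite (?S lam)" if "is_partition lam" for lam
    using bij_betw_finite[OF bij[OF that]] finite_patterns_straight by blast

  have L_eq: "{p \<in> SSYT \<mu> \<times> SSYT \<nu>. entries \<mu> (fst p) + entries \<nu> (snd p) = \<alpha>} =
      {p \<in> ?S \<mu> \<times> ?S \<nu>. entries \<mu> (fst p) + entries \<nu> (snd p) = \<alpha>}" (is "?L = ?L'")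
  proof (intro equalityI subsetI)
    fix p assume p: "p \<in> ?L"
    then have "fst p \<in> ?S \<mu>" "snd p \<in> ?S \<nu>" using S_I[of "fst p" \<mu>] S_I[of "snd p" \<nu>] by auto
    then show "p \<in> ?L'" using p by (simp add: mem_Times_iff)
  qed auto
  show "finite ?L"
    unfolding L_eq by (rule finite_subset[of _ "?S \<mu> \<times> ?S \<nu>"]) (use fin_S mu nu in auto)
  have "bij_betw (map_prod (?tp \<mu>) (?tp \<nu>)) ?L'
      {p \<in> ?P ?\<mu> \<times> ?P ?\<nu>. \<forall>k<N. ?w (fst p) k + ?w (snd p) k = ?a k}"
  proof (rule bij_betw_filter)
    show "bij_betw (map_prod (?tp \<mu>) (?tp \<nu>)) (?S \<mu> \<times> ?S \<nu>) (?P ?\<mu> \<times> ?P ?\<nu>)"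
      using bij[OF mu] bij[OF nu] by (rule bij_betw_map_prod)
    fix p assume "p \<in> ?S \<mu> \<times> ?S \<nu>"
    then have "set_mset (entries \<mu> (fst p) + entries \<nu> (snd p)) \<subseteq> {1..N}"
      using set_S[of "fst p" \<mu>] set_S[of "snd p" \<nu>] by (auto simp: mem_Times_iff)
    then have "entries \<mu> (fst p) + entries \<nu> (snd p) = \<alpha> \<longleftrightarrow>
        (\<forall>k<N. count (entries \<mu> (fst p) + entries \<nu> (snd p)) (Suc k) = ?a k)"
      by (rule multiset_eq_iff_bounded[OF _ \<alpha>])
    then show "entries \<mu> (fst p) + entries \<nu> (snd p) = \<alpha> \<longleftrightarrow>
        (\<forall>k<N. ?w (fst (map_prod (?tp \<mu>) (?tp \<nu>) p)) k + ?w (snd (map_prod (?tp \<mu>) (?tp \<nu>) p)) k = ?a k)"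
      using count_entries[OF mu, of N] count_entries[OF nu, of N] parts_beyond by simp
  qed
  then have "card ?L = card {p \<in> ?P ?\<mu> \<times> ?P ?\<nu>. \<forall>k<N. ?w (fst p) k + ?w (snd p) k = ?a k}"
    unfolding L_eq by (rule bij_betw_same_card)

  also have "\<dots> = card {p \<in> (SIGMA g:{g \<in> ?P ?\<nu>. dominant ?\<mu> g}. ?P (\<lambda>k. ?\<mu> k + ?w g k)). \<forall>k<N. ?w (snd p) k = ?a k}"
    by (rule card_pattern_pairs) (use mu parts_beyond(1) in \<open>auto simp: is_partition_def\<close>)
  also have "{p \<in> (SIGMA g:{g \<in> ?P ?\<nu>. dominant ?\<mu> g}. ?P (\<lambda>k. ?\<mu> k + ?w g k)). \<forall>k<N. ?w (snd p) k = ?a k} =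
      (SIGMA g:{g \<in> ?P ?\<nu>. dominant ?\<mu> g}. {b \<in> ?P (\<lambda>k. pattern_shape N \<mu> g (Suc k)). \<forall>k<N. ?w b k = ?a k})"
    by (auto simp: pattern_shape_def)
  also have "card \<dots> = (\<Sum>g\<in>{g \<in> ?P ?\<nu>. dominant ?\<mu> g}. card {b \<in> ?P (\<lambda>k. pattern_shape N \<mu> g (Suc k)). \<forall>k<N. ?w b k = ?a k})"
    by (rule card_SigmaI) (auto simp: finite_patterns_straight)
  \<comment> \<open>Dominant patterns are grouped by the shape they reach; by
    \<open>LR_coeff_eq_card_shape\<close> each group has \<open>LR_coeff\<close> members.\<close>
  also have "\<dots> = (\<Sum>lam\<in>LR_shapes \<mu> \<nu>. \<Sum>g\<in>{g \<in> {g \<in> ?P ?\<nu>. dominant ?\<mu> g}. pattern_shape N \<mu> g = lam}.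
      card {b \<in> ?P (\<lambda>k. pattern_shape N \<mu> g (Suc k)). \<forall>k<N. ?w b k = ?a k})"
    by (rule sum.group[symmetric])
      (auto simp: finite_patterns_straight finite_LR_shapes pattern_shape_in_LR_shapes)
  also have "\<dots> = (\<Sum>lam\<in>LR_shapes \<mu> \<nu>. LR_coeff \<mu> \<nu> lam * card {b \<in> ?P (\<lambda>k. lam (Suc k)). \<forall>k<N. ?w b k = ?a k})"
  proof (intro sum.cong refl)
    fix lam assume lam: "lam \<in> LR_shapes \<mu> \<nu>"
    have "(\<Sum>g\<in>{g \<in> {g \<in> ?P ?\<nu>. dominant ?\<mu> g}. pattern_shape N \<mu> g = lam}.
        card {b \<in> ?P (\<lambda>k. pattern_shape N \<mu> g (Suc k)). \<forall>k<N. ?w b k = ?a k}) =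
      (\<Sum>g\<in>{g \<in> {g \<in> ?P ?\<nu>. dominant ?\<mu> g}. pattern_shape N \<mu> g = lam}.
        card {b \<in> ?P (\<lambda>k. lam (Suc k)). \<forall>k<N. ?w b k = ?a k})"
      by (rule sum.cong) auto
    then show "(\<Sum>g\<in>{g \<in> {g \<in> ?P ?\<nu>. dominant ?\<mu> g}. pattern_shape N \<mu> g = lam}.
        card {b \<in> ?P (\<lambda>k. pattern_shape N \<mu> g (Suc k)). \<forall>k<N. ?w b k = ?a k}) =
      LR_coeff \<mu> \<nu> lam * card {b \<in> ?P (\<lambda>k. lam (Suc k)). \<forall>k<N. ?w b k = ?a k}"
      unfolding LR_coeff_eq_card_shape[OF lam] by simp
  qed
  also have "\<dots> = (\<Sum>lam\<in>LR_shapes \<mu> \<nu>. LR_coeff \<mu> \<nu> lam * card {M \<in> SSYT lam. entries lam M = \<alpha>})"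
  proof (intro sum.cong refl arg_cong2[of _ _ _ _ "(*)"])
    fix lam assume lam: "lam \<in> LR_shapes \<mu> \<nu>"
    note part = LR_shapes_weight(1)[OF lam]
    have eq: "{M \<in> SSYT lam. entries lam M = \<alpha>} = {M \<in> ?S lam. entries lam M = \<alpha>}"
      using S_I by auto
    have "bij_betw (?tp lam) {M \<in> ?S lam. entries lam M = \<alpha>} {b \<in> ?P (\<lambda>k. lam (Suc k)). \<forall>k<N. ?w b k = ?a k}"
    proof (rule bij_betw_filter[OF bij[OF part]])
      fix M assume "M \<in> ?S lam"
      then show "entries lam M = \<alpha> \<longleftrightarrow> (\<forall>k<N. ?w (?tp lam M) k = ?a k)"
        using multiset_eq_iff_bounded[OF set_S \<alpha>, of M lam] count_entries[OF part, of N] parts_beyond(3) lam by simp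
    qed
    then show "card {b \<in> ?P (\<lambda>k. lam (Suc k)). \<forall>k<N. ?w b k = ?a k} = card {M \<in> SSYT lam. entries lam M = \<alpha>}"
      unfolding eq by (rule bij_betw_same_card[symmetric])
  qed
  finally show "card ?L = (\<Sum>lam\<in>LR_shapes \<mu> \<nu>. LR_coeff \<mu> \<nu> lam * card {M \<in> SSYT lam. entries lam M = \<alpha>})" .
  assume lam: "lam \<in> LR_shapes \<mu> \<nu>"
  show "finite {M \<in> SSYT lam. entries lam M = \<alpha>}"
    by (rule finite_subset[OF _ fin_S[OF LR_shapes_weight(1)[OF lam]]]) (use S_I in auto)
qed

end

text \<open>Each shape is taken in as many numbered copies as its coefficient, so that
  multiplicities become part of the index set of a bijection.\<close>

definition LR_index :: "(nat \<Rightarrow> nat) \<Rightarrow> (nat \<Rightarrow> nat) \<Rightarrow> ((nat \<Rightarrow> nat) \<times> nat) set" where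
  "LR_index \<mu> \<nu> = (SIGMA lam:LR_shapes \<mu> \<nu>. {..<LR_coeff \<mu> \<nu> lam})"

lemma card_entries_pairs:
  assumes mu: "is_partition \<mu>" and nu: "is_partition \<nu>"
  shows "finite {p \<in> SSYT \<mu> \<times> SSYT \<nu>. entries \<mu> (fst p) + entries \<nu> (snd p) = \<alpha>}" (is "finite ?L")
    and "finite {p \<in> (SIGMA k:LR_index \<mu> \<nu>. SSYT (fst k)). entries (fst (fst p)) (snd p) = \<alpha>}" (is "finite ?R")
    and "card {p \<in> SSYT \<mu> \<times> SSYT \<nu>. entries \<mu> (fst p) + entries \<nu> (snd p) = \<alpha>} =
      card {p \<in> (SIGMA k:LR_index \<mu> \<nu>. SSYT (fst k)). entries (fst (fst p)) (snd p) = \<alpha>}"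
proof -
  have "finite ?L \<and> finite ?R \<and> card ?L = card ?R"
  proof (cases "0 \<in># \<alpha>")
    case True
    have "0 \<notin># entries lam M" if "M \<in> SSYT lam" for lam M
      using SSYT_pos[OF that] by (fastforce simp: set_entries)
    then have empty: "?L = {}" "?R = {}" using True by fastforce+
    show ?thesis unfolding empty by simp
  next
    case False
    \<comment> \<open>The weights bound the number of rows of all shapes involved, and the sum of
      \<alpha> bounds each of its elements.\<close>
    define N where "N = weight \<mu> + weight \<nu> + \<Sum>\<^sub># \<alpha>"
    have "x \<le> \<Sum>\<^sub># \<alpha>" if "x \<in># \<alpha>" for x 
      using that by (auto dest!: multi_member_split)
    then have \<alpha>: "set_mset \<alpha> \<subseteq> {1..N}"
      using False by (fastforce simp: N_def Suc_le_eq intro: gr0I)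
    have N: "weight \<mu> + weight \<nu> \<le> N" by (simp add: N_def)
    note bounded = card_entries_pairs_bounded[OF mu nu N \<alpha>]
    have R: "?R = (SIGMA k:LR_index \<mu> \<nu>. {M \<in> SSYT (fst k). entries (fst k) M = \<alpha>})" by auto
    have fin: "finite (LR_index \<mu> \<nu>)" by (simp add: LR_index_def finite_LR_shapes)
    have fin': "finite {M \<in> SSYT (fst k). entries (fst k) M = \<alpha>}" if "k \<in> LR_index \<mu> \<nu>" for k
      using bounded(3)[of "fst k"] that by (auto simp: LR_index_def)
    have "card ?R = (\<Sum>k\<in>LR_index \<mu> \<nu>. card {M \<in> SSYT (fst k). entries (fst k) M = \<alpha>})"
      unfolding R by (rule card_SigmaI) (use fin fin' in auto)
    also have "\<dots> = (\<Sum>lam\<in>LR_shapes \<mu> \<nu>. LR_coeff \<mu> \<nu> lam * card {M \<in> SSYT lam. entries lam M = \<alpha>})"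
      unfolding LR_index_def using finite_LR_shapes[of \<mu> \<nu>]
      by (subst sum.Sigma[symmetric, where g = "\<lambda>lam _. card {M \<in> SSYT lam. entries lam M = \<alpha>}", simplified case_prod_unfold]) auto
    finally show ?thesis
      using bounded(1,2) R fin fin' by (auto intro!: finite_SigmaI)
  qed
  then show "finite ?L" "finite ?R" "card ?L = card ?R" by auto
qed

subsection \<open>Symmetrised zeta functions\<close>

lemma has_sum_finite_sum:
  fixes f :: "'s \<Rightarrow> 'i \<Rightarrow> 'a::topological_comm_monoid_add"
  assumes "finite S" "\<And>s. s \<in> S \<Longrightarrow> (f s has_sum a s) A"
  shows "((\<lambda>x. \<Sum>s\<in>S. f s x) has_sum (\<Sum>s\<in>S. a s)) A"
  using assms by (induction S rule: finite_induct) (auto intro!: has_sum_add)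

lemma infsum_finite_Sigma:
  fixes F :: "'k \<Rightarrow> 'b \<Rightarrow> 'a::{topological_comm_monoid_add, t2_space}"
  assumes "finite K" "\<And>k. k \<in> K \<Longrightarrow> F k summable_on B k"
  shows "(\<Sum>k\<in>K. infsum (F k) (B k)) = infsum (\<lambda>p. F (fst p) (snd p)) (Sigma K B)"
proof -
  let ?f = "\<lambda>p. F (fst p) (snd p)"
  have inj: "inj_on (Pair k) (B k)" for k by (simp add: inj_on_def)
  have "?f summable_on (Pair k ` B k)" if "k \<in> K" for k
    using assms(2)[OF that] by (simp add: summable_on_reindex[OF inj] comp_def)
  then have "(\<Sum>k\<in>K. infsum ?f (Pair k ` B k)) = infsum ?f (\<Union>k\<in>K. Pair k ` B k)"
    by (intro sum_infsum assms(1)) auto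
  moreover have "(\<Union>k\<in>K. Pair k ` B k) = Sigma K B" by auto
  ultimately show ?thesis by (simp add: infsum_reindex[OF inj] comp_def)
qed

text \<open>A finite set of functions lies in the product of its projections, over which the sum of
  products factorises. All partial sums are thus bounded by the product of the one-variable
  sums.\<close>

lemma abs_summable_on_prod_PiE_nat:
  fixes f :: "'v \<Rightarrow> nat \<Rightarrow> complex"
  assumes V: "finite V" and f: "\<And>v. v \<in> V \<Longrightarrow> (\<lambda>k. norm (f v k)) summable_on B v"
  shows "(\<lambda>m. norm (\<Prod>v\<in>V. f v (m v))) summable_on (PiE V B)"
  unfolding abs_summable_iff_bdd_above
proof (rule bdd_aboveI2)
  fix F assume "F \<in> {F. F \<subseteq> PiE V B \<and> finite F}"
  then have F: "F \<subseteq> PiE V B" "finite F" by auto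
  let ?C = "\<lambda>v. (\<lambda>m. m v) ` F"
  have "(\<Sum>m\<in>F. norm (\<Prod>v\<in>V. f v (m v))) = (\<Sum>m\<in>F. \<Prod>v\<in>V. norm (f v (m v)))"
    by (simp add: prod_norm)
  also have "\<dots> \<le> (\<Sum>m\<in>PiE V ?C. \<Prod>v\<in>V. norm (f v (m v)))"
    using F V by (intro sum_mono2 finite_PiE prod_nonneg) (auto simp: PiE_def)
  also have "\<dots> = (\<Prod>v\<in>V. \<Sum>k\<in>?C v. norm (f v k))"
    using F V by (intro prod_sum_PiE[symmetric]) auto
  also have "\<dots> \<le> (\<Prod>v\<in>V. infsum (\<lambda>k. norm (f v k)) (B v))"
    using F f by (intro prod_mono conjI sum_nonneg finite_sum_le_infsum) (auto simp: PiE_def Pi_def)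
  finally show "(\<Sum>m\<in>F. norm (\<Prod>v\<in>V. f v (m v))) \<le> (\<Prod>v\<in>V. infsum (\<lambda>k. norm (f v k)) (B v))" .
qed

lemma abs_summable_on_inverse_powr:
  assumes "Re z > 1"
  shows "(\<lambda>k::nat. norm (1 / (of_nat k powr z))) summable_on {1..}"
proof -
  have "(\<lambda>k. real k powr - Re z) summable_on UNIV"
    using assms by (intro summable_nonneg_imp_summable_on) (auto simp: summable_real_powr_iff)
  then have "(\<lambda>k. real k powr - Re z) summable_on {1..}"
    by (rule summable_on_subset_banach) simp
  moreover have "norm (1 / (of_nat k powr z)) = real k powr - Re z" for k
    by (simp add: norm_divide norm_powr_real_powr powr_minus_divide)
  ultimately show ?thesis by simp
qed

text \<open>An injectively indexed family is part of the family of all functions from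
  \<open>V\<close> to the positive integers, for which the sum splits into one-variable
  series.\<close>

lemma summable_on_inverse_powr_family:
  assumes "finite V" "\<And>v. v \<in> V \<Longrightarrow> Re (y v) > 1"
    and "inj_on m I" "m ` I \<subseteq> V \<rightarrow>\<^sub>E {1::nat..}"
  shows "(\<lambda>i. \<Prod>v\<in>V. 1 / (of_nat (m i v) powr y v)) summable_on I"
proof -
  have "(\<lambda>m. \<Prod>v\<in>V. 1 / (of_nat (m v) powr y v)) summable_on (V \<rightarrow>\<^sub>E {1::nat..})"
    by (rule abs_summable_summable[OF abs_summable_on_prod_PiE_nat[OF assms(1)
          abs_summable_on_inverse_powr[OF assms(2)]]])
  then have "(\<lambda>m. \<Prod>v\<in>V. 1 / (of_nat (m v) powr y v)) summable_on (m ` I)"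
    by (rule summable_on_subset_banach[OF _ assms(4)])
  then show ?thesis by (simp add: summable_on_reindex[OF assms(3)] comp_def)
qed

definition sym_monomial :: "'v set \<Rightarrow> ('v \<Rightarrow> complex) \<Rightarrow> ('v \<Rightarrow> nat) \<Rightarrow> complex" where
  "sym_monomial V x m = (\<Sum>\<sigma> | \<sigma> permutes V. \<Prod>v\<in>V. 1 / (of_nat (m v) powr x (\<sigma> v)))"

text \<open>Functions with the same multiset of values differ by a permutation of \<open>V\<close>,
  which the sum over all permutations absorbs. This is why the fillings \<open>u\<close> in the
  theorem may be arbitrary.\<close>

lemma sym_monomial_cong:
  assumes "finite V" "image_mset m (mset_set V) = image_mset m' (mset_set V)"
  shows "sym_monomial V x m = sym_monomial V x m'"
proof -
  obtain p where p: "p permutes V" "\<forall>v\<in>V. m v = m' (p v)"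
    using image_mset_eq_implies_permutes[OF assms] by blast
  have "(\<Prod>v\<in>V. 1 / (of_nat (m v) powr x (\<sigma> v))) = (\<Prod>v\<in>V. 1 / (of_nat (m' v) powr x ((\<sigma> \<circ> inv p) v)))" for \<sigma>
  proof -
    have "(\<Prod>v\<in>V. 1 / (of_nat (m v) powr x (\<sigma> v))) =
        (\<Prod>v\<in>V. (\<lambda>v. 1 / (of_nat (m' v) powr x (\<sigma> (inv p v)))) (p v))"
      using p by (intro prod.cong) (auto simp: permutes_inverses)
    also have "\<dots> = (\<Prod>v\<in>V. 1 / (of_nat (m' v) powr x (\<sigma> (inv p v))))"
      using p(1) by (intro prod.reindex_bij_betw permutes_imp_bij)
    finally show ?thesis by simp
  qed
  then show ?thesis
    unfolding sym_monomial_def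
    by (simp add: sum_permutations_compose_right[OF permutes_inv[OF p(1)],
          where f = "\<lambda>\<sigma>. \<Prod>v\<in>V. 1 / (of_nat (m' v) powr x (\<sigma> v))"])
qed

lemma has_sum_sym_monomial:
  assumes V: "finite V" and x: "\<And>v. v \<in> V \<Longrightarrow> Re (x v) > 1"
    and m: "inj_on m I" "m ` I \<subseteq> V \<rightarrow>\<^sub>E {1::nat..}"
  shows "((\<lambda>i. sym_monomial V x (m i)) has_sum
    (\<Sum>\<sigma> | \<sigma> permutes V. \<Sum>\<^sub>\<infinity>i\<in>I. \<Prod>v\<in>V. 1 / (of_nat (m i v) powr x (\<sigma> v)))) I"
  unfolding sym_monomial_def
proof (rule has_sum_finite_sum)
  fix \<sigma> assume "\<sigma> \<in> {\<sigma>. \<sigma> permutes V}"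
  then have "Re (x (\<sigma> v)) > 1" if "v \<in> V" for v
    using x that by (simp add: permutes_in_image)
  then show "((\<lambda>i. \<Prod>v\<in>V. 1 / (of_nat (m i v) powr x (\<sigma> v))) has_sum
      (\<Sum>\<^sub>\<infinity>i\<in>I. \<Prod>v\<in>V. 1 / (of_nat (m i v) powr x (\<sigma> v)))) I"
    by (intro has_sum_infsum summable_on_inverse_powr_family[OF V _ m])
qed (simp add: V finite_permutations)

lemma inverse_tableau_power:
  "1 / tableau_power lam M (\<lambda>p\<in>diagram lam. z p) = (\<Prod>p\<in>diagram lam. 1 / (of_nat (M p) powr z p))"
  by (simp add: tableau_power_def prod_dividef)

lemma SSYT_eqI:
  assumes "M \<in> SSYT lam" "M' \<in> SSYT lam" "\<And>p. p \<in> diagram lam \<Longrightarrow> M p = M' p"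
  shows "M = M'"
  using assms by (intro extensionalityI[of M "diagram lam" M']) (auto simp: SSYT_def fillings_def PiE_def)

text \<open>The tableau is moved from the boxes to the indeterminates that \<open>u\<close> places
  in them, so that tableaux of all shapes become functions on one common set.\<close>

definition relabel :: "(nat \<Rightarrow> nat) \<Rightarrow> (nat \<times> nat \<Rightarrow> 'v) \<Rightarrow> (nat \<times> nat \<Rightarrow> nat) \<Rightarrow> 'v \<Rightarrow> nat" where
  "relabel lam u M = (\<lambda>v\<in>u ` diagram lam. M (inv_into (diagram lam) u v))"

lemma relabel_props:
  assumes u: "bij_betw u (diagram lam) V"
  shows "inj_on (relabel lam u) (SSYT lam)" "relabel lam u ` SSYT lam \<subseteq> V \<rightarrow>\<^sub>E {1..}"
    and "image_mset (relabel lam u M) (mset_set V) = entries lam M"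
    and "(\<Prod>v\<in>V. 1 / (of_nat (relabel lam u M v) powr y v)) = (\<Prod>p\<in>diagram lam. 1 / (of_nat (M p) powr (y (u p) :: complex)))"
proof -
  have inj: "inj_on u (diagram lam)" and V: "u ` diagram lam = V"
    using u by (auto simp: bij_betw_def)
  have val: "relabel lam u M (u p) = M p" if "p \<in> diagram lam" for M p
    using that inj by (simp add: relabel_def)
  show "inj_on (relabel lam u) (SSYT lam)"
  proof (rule inj_onI)
    fix M M' assume M: "M \<in> SSYT lam" "M' \<in> SSYT lam" "relabel lam u M = relabel lam u M'"
    have "M p = M' p" if "p \<in> diagram lam" for p using val[OF that] M(3) by metis
    then show "M = M'" by (rule SSYT_eqI[OF M(1,2)])
  qed
  show "relabel lam u ` SSYT lam \<subseteq> V \<rightarrow>\<^sub>E {1..}"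
  proof
    fix m assume "m \<in> relabel lam u ` SSYT lam"
    then obtain M where M: "M \<in> SSYT lam" "m = relabel lam u M" by blast
    have "1 \<le> m v" if "v \<in> V" for v
    proof -
      obtain p where "p \<in> diagram lam" "v = u p" using \<open>v \<in> V\<close> V by blast
      then show ?thesis using val SSYT_pos[OF M(1)] M(2) by simp
    qed
    then show "m \<in> V \<rightarrow>\<^sub>E {1..}" using V M(2) by (auto simp: relabel_def)
  qed
  have "mset_set V = image_mset u (mset_set (diagram lam))"
    using image_mset_mset_set[OF inj] V by simp
  then show "image_mset (relabel lam u M) (mset_set V) = entries lam M"
    unfolding entries_def
    by (simp add: image_mset.compositionality comp_def)
      (intro image_mset_cong, simp add: finite_diagram val)
  show "(\<Prod>v\<in>V. 1 / (of_nat (relabel lam u M v) powr y v)) = (\<Prod>p\<in>diagram lam. 1 / (of_nat (M p) powr (y (u p) :: complex)))"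
    unfolding prod.reindex_bij_betw[OF u, symmetric] by (intro prod.cong) (simp_all add: val)
qed

definition join :: "(nat \<Rightarrow> nat) \<Rightarrow> (nat \<Rightarrow> nat) \<Rightarrow> (nat \<times> nat \<Rightarrow> nat) \<times> (nat \<times> nat \<Rightarrow> nat) \<Rightarrow>
    (nat \<times> nat) + (nat \<times> nat) \<Rightarrow> nat" where
  "join \<mu> \<nu> P = (\<lambda>v\<in>indets \<mu> \<nu>. case_sum (fst P) (snd P) v)"

lemma finite_indets: "finite (indets \<mu> \<nu>)"
  by (simp add: indets_def finite_diagram)

lemma join_props:
  shows "inj_on (join \<mu> \<nu>) (SSYT \<mu> \<times> SSYT \<nu>)"
    and "join \<mu> \<nu> ` (SSYT \<mu> \<times> SSYT \<nu>) \<subseteq> indets \<mu> \<nu> \<rightarrow>\<^sub>E {1..}"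
    and "image_mset (join \<mu> \<nu> P) (mset_set (indets \<mu> \<nu>)) = entries \<mu> (fst P) + entries \<nu> (snd P)"
    and "(\<Prod>v\<in>indets \<mu> \<nu>. 1 / (of_nat (join \<mu> \<nu> P v) powr y v)) =
      (\<Prod>p\<in>diagram \<mu>. 1 / (of_nat (fst P p) powr (y (Inl p) :: complex))) *
      (\<Prod>q\<in>diagram \<nu>. 1 / (of_nat (snd P q) powr y (Inr q)))"
proof -
  have val: "p \<in> diagram \<mu> \<Longrightarrow> join \<mu> \<nu> P (Inl p) = fst P p" "q \<in> diagram \<nu> \<Longrightarrow> join \<mu> \<nu> P (Inr q) = snd P q" for P p q
    by (simp_all add: join_def indets_def InlI InrI)
  show "inj_on (join \<mu> \<nu>) (SSYT \<mu> \<times> SSYT \<nu>)"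
  proof (rule inj_onI)
    fix P Q assume P: "P \<in> SSYT \<mu> \<times> SSYT \<nu>" and Q: "Q \<in> SSYT \<mu> \<times> SSYT \<nu>" and eq: "join \<mu> \<nu> P = join \<mu> \<nu> Q"
    have "fst P p = fst Q p" if "p \<in> diagram \<mu>" for p using val(1)[OF that] eq by metis
    moreover have "snd P q = snd Q q" if "q \<in> diagram \<nu>" for q using val(2)[OF that] eq by metis
    ultimately have "fst P = fst Q" "snd P = snd Q"
      using P Q SSYT_eqI[of "fst P" \<mu> "fst Q"] SSYT_eqI[of "snd P" \<nu> "snd Q"] by auto
    then show "P = Q" by (rule prod_eqI)
  qed
  show "join \<mu> \<nu> ` (SSYT \<mu> \<times> SSYT \<nu>) \<subseteq> indets \<mu> \<nu> \<rightarrow>\<^sub>E {1..}"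
    using SSYT_pos by (fastforce simp: join_def indets_def split: sum.split)
  have "mset_set (indets \<mu> \<nu>) = image_mset Inl (mset_set (diagram \<mu>)) + image_mset Inr (mset_set (diagram \<nu>))"
    unfolding indets_def Plus_def
    by (subst mset_set_Union) (auto simp: finite_diagram image_mset_mset_set)
  then show "image_mset (join \<mu> \<nu> P) (mset_set (indets \<mu> \<nu>)) = entries \<mu> (fst P) + entries \<nu> (snd P)"
    by (simp add: entries_def image_mset.compositionality comp_def)
      (intro arg_cong2[of _ _ _ _ "(+)"] image_mset_cong, simp_all add: finite_diagram val)
  show "(\<Prod>v\<in>indets \<mu> \<nu>. 1 / (of_nat (join \<mu> \<nu> P v) powr y v)) =
      (\<Prod>p\<in>diagram \<mu>. 1 / (of_nat (fst P p) powr (y (Inl p) :: complex))) *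
      (\<Prod>q\<in>diagram \<nu>. 1 / (of_nat (snd P q) powr y (Inr q)))"
    unfolding indets_def prod.Plus[OF finite_diagram finite_diagram]
    by (intro arg_cong2[of _ _ _ _ "(*)"] prod.cong) (simp_all add: val)
qed

lemma infsum_product_summable:
  fixes f :: "'a \<Rightarrow> complex" and g :: "'b \<Rightarrow> complex"
  assumes "(\<lambda>p. f (fst p) * g (snd p)) summable_on A \<times> B"
  shows "infsum f A * infsum g B = infsum (\<lambda>p. f (fst p) * g (snd p)) (A \<times> B)"
proof -
  have "infsum (\<lambda>p. f (fst p) * g (snd p)) (A \<times> B) = infsum (\<lambda>a. infsum (\<lambda>b. f a * g b) B) A"
    using infsum_Sigma_banach[OF assms] by simp
  then show ?thesis by (simp add: infsum_cmult_right' infsum_cmult_left')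
qed

theorem theorem1p6:
  fixes \<mu> \<nu> :: "nat \<Rightarrow> nat"
    and s t :: "nat \<times> nat \<Rightarrow> complex"
    and u :: "(nat \<Rightarrow> nat) \<Rightarrow> nat \<times> nat \<Rightarrow> (nat \<times> nat) + (nat \<times> nat)"
  assumes "is_partition \<mu>" and "is_partition \<nu>"
    and "s \<in> fillings \<mu> UNIV" and "t \<in> fillings \<nu> UNIV"
    and "\<And>p. p \<in> diagram \<mu> \<Longrightarrow> Re (s p) > 1"
    and "\<And>q. q \<in> diagram \<nu> \<Longrightarrow> Re (t q) > 1"
    and "\<And>lam. lam \<in> LR_shapes \<mu> \<nu> \<Longrightarrow>
           u lam \<in> fillings lam (indets \<mu> \<nu>) \<and> bij_betw (u lam) (diagram lam) (indets \<mu> \<nu>)"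
  shows "sym_sum (indets \<mu> \<nu>)
           (\<lambda>x. schur_zeta \<mu> (\<lambda>p\<in>diagram \<mu>. x (Inl p)) * schur_zeta \<nu> (\<lambda>q\<in>diagram \<nu>. x (Inr q)))
           (case_sum s t) =
         sym_sum (indets \<mu> \<nu>)
           (\<lambda>x. \<Sum>lam\<in>LR_shapes \<mu> \<nu>.
                  of_nat (LR_coeff \<mu> \<nu> lam) * schur_zeta lam (\<lambda>p\<in>diagram lam. x (u lam p)))
           (case_sum s t)"
proof -
  define V where "V = indets \<mu> \<nu>"
  define x where "x = case_sum s t"
  have V: "finite V" by (simp add: V_def finite_indets)
  have x: "Re (x v) > 1" if "v \<in> V" for v
    using that assms(5,6) by (auto simp: V_def indets_def x_def)
  have u: "bij_betw (u lam) (diagram lam) V" if "lam \<in> LR_shapes \<mu> \<nu>" for lam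
    using assms(7)[OF that] by (simp add: V_def)
  let ?I = "SSYT \<mu> \<times> SSYT \<nu>" and ?J = "SIGMA k:LR_index \<mu> \<nu>. SSYT (fst k)"
  let ?m = "\<lambda>q. relabel (fst (fst q)) (u (fst (fst q))) (snd q)"
  have J_mset: "image_mset (?m q) (mset_set V) = entries (fst (fst q)) (snd q)" if "q \<in> ?J" for q
    using that u by (intro relabel_props(3)) (auto simp: LR_index_def)

  have "sym_sum V (\<lambda>x. schur_zeta \<mu> (\<lambda>p\<in>diagram \<mu>. x (Inl p)) * schur_zeta \<nu> (\<lambda>q\<in>diagram \<nu>. x (Inr q))) x =
      (\<Sum>\<sigma> | \<sigma> permutes V. \<Sum>\<^sub>\<infinity>P\<in>?I. \<Prod>v\<in>V. 1 / (of_nat (join \<mu> \<nu> P v) powr x (\<sigma> v)))"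
    unfolding sym_sum_def
  proof (intro sum.cong refl)
    fix \<sigma> assume "\<sigma> \<in> {\<sigma>. \<sigma> permutes V}"
    then have "Re ((x \<circ> \<sigma>) v) > 1" if "v \<in> V" for v
      using x that by (simp add: permutes_in_image)
    then have "(\<lambda>P. \<Prod>v\<in>V. 1 / (of_nat (join \<mu> \<nu> P v) powr (x \<circ> \<sigma>) v)) summable_on ?I"
      using V join_props(1,2)[of \<mu> \<nu>] unfolding V_def by (intro summable_on_inverse_powr_family)
    then show "schur_zeta \<mu> (\<lambda>p\<in>diagram \<mu>. (x \<circ> \<sigma>) (Inl p)) * schur_zeta \<nu> (\<lambda>q\<in>diagram \<nu>. (x \<circ> \<sigma>) (Inr q)) =
        (\<Sum>\<^sub>\<infinity>P\<in>?I. \<Prod>v\<in>V. 1 / (of_nat (join \<mu> \<nu> P v) powr x (\<sigma> v)))"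
      unfolding schur_zeta_def inverse_tableau_power V_def join_props(4)
      by (subst infsum_product_summable) (simp_all add: join_props(4))
  qed
  also have "\<dots> = (\<Sum>\<^sub>\<infinity>P\<in>?I. sym_monomial V x (join \<mu> \<nu> P))"
    using has_sum_sym_monomial[where x = x and m = "join \<mu> \<nu>" and I = ?I, OF V x] join_props(1,2)[of \<mu> \<nu>]
    by (simp add: V_def infsumI)
  \<comment> \<open>Both summands depend only on the multiset of entries, so a content-preserving
    bijection matches them term by term.\<close>
  also have "\<dots> = (\<Sum>\<^sub>\<infinity>q\<in>?J. sym_monomial V x (?m q))"
  proof -
    obtain h where h: "bij_betw h ?I ?J"
      "\<And>P. P \<in> ?I \<Longrightarrow> entries (fst (fst (h P))) (snd (h P)) = entries \<mu> (fst P) + entries \<nu> (snd P)"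
      by (rule exists_fibre_preserving_bij[OF card_entries_pairs[OF assms(1,2)]]) blast
    have "sym_monomial V x (join \<mu> \<nu> P) = sym_monomial V x (?m (h P))" if "P \<in> ?I" for P
      using J_mset[of "h P"] bij_betwE[OF h(1)] h(2)[OF that] that
      by (intro sym_monomial_cong V) (simp add: join_props(3) V_def)
    then have "(\<Sum>\<^sub>\<infinity>P\<in>?I. sym_monomial V x (join \<mu> \<nu> P)) = (\<Sum>\<^sub>\<infinity>P\<in>?I. sym_monomial V x (?m (h P)))"
      by (rule infsum_cong)
    then show ?thesis using infsum_reindex_bij_betw[OF h(1), of "\<lambda>q. sym_monomial V x (?m q)"] by simp
  qed
  also have "\<dots> = (\<Sum>k\<in>LR_index \<mu> \<nu>. \<Sum>\<^sub>\<infinity>M\<in>SSYT (fst k). sym_monomial V x (relabel (fst k) (u (fst k)) M))"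
  proof (rule infsum_finite_Sigma[symmetric])
    show "finite (LR_index \<mu> \<nu>)" by (simp add: LR_index_def finite_LR_shapes)
    fix k assume "k \<in> LR_index \<mu> \<nu>"
    then have "bij_betw (u (fst k)) (diagram (fst k)) V" using u by (auto simp: LR_index_def)
    from has_sum_sym_monomial[where x = x, OF V x relabel_props(1,2)[OF this]]
    show "(\<lambda>M. sym_monomial V x (relabel (fst k) (u (fst k)) M)) summable_on SSYT (fst k)"
      by (auto simp: summable_on_def)
  qed
  \<comment> \<open>The series is the same for every copy of a shape, so the copies add up to the
    factor \<open>LR_coeff\<close>.\<close>
  also have "\<dots> = (\<Sum>lam\<in>LR_shapes \<mu> \<nu>. of_nat (LR_coeff \<mu> \<nu> lam) *
      (\<Sum>\<^sub>\<infinity>M\<in>SSYT lam. sym_monomial V x (relabel lam (u lam) M)))"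
    unfolding LR_index_def
    using sum.Sigma[of "LR_shapes \<mu> \<nu>" "\<lambda>lam. {..<LR_coeff \<mu> \<nu> lam}"
        "\<lambda>lam _. \<Sum>\<^sub>\<infinity>M\<in>SSYT lam. sym_monomial V x (relabel lam (u lam) M)"]
    by (simp add: finite_LR_shapes case_prod_unfold)
  also have "\<dots> = (\<Sum>lam\<in>LR_shapes \<mu> \<nu>. of_nat (LR_coeff \<mu> \<nu> lam) *
      (\<Sum>\<sigma> | \<sigma> permutes V. schur_zeta lam (\<lambda>p\<in>diagram lam. (x \<circ> \<sigma>) (u lam p))))"
  proof (intro sum.cong refl arg_cong2[of _ _ _ _ "(*)"])
    fix lam assume "lam \<in> LR_shapes \<mu> \<nu>"
    note u' = u[OF this]
    have "(\<Sum>\<^sub>\<infinity>M\<in>SSYT lam. sym_monomial V x (relabel lam (u lam) M)) =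
        (\<Sum>\<sigma> | \<sigma> permutes V. \<Sum>\<^sub>\<infinity>M\<in>SSYT lam. \<Prod>v\<in>V. 1 / (of_nat (relabel lam (u lam) M v) powr x (\<sigma> v)))"
      by (rule infsumI[OF has_sum_sym_monomial[where x = x, OF V x relabel_props(1,2)[OF u']]])
    then show "(\<Sum>\<^sub>\<infinity>M\<in>SSYT lam. sym_monomial V x (relabel lam (u lam) M)) =
        (\<Sum>\<sigma> | \<sigma> permutes V. schur_zeta lam (\<lambda>p\<in>diagram lam. (x \<circ> \<sigma>) (u lam p)))"
      unfolding schur_zeta_def inverse_tableau_power relabel_props(4)[OF u'] by simp
  qed
  also have "\<dots> = (\<Sum>\<sigma> | \<sigma> permutes V. \<Sum>lam\<in>LR_shapes \<mu> \<nu>. of_nat (LR_coeff \<mu> \<nu> lam) *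
      schur_zeta lam (\<lambda>p\<in>diagram lam. (x \<circ> \<sigma>) (u lam p)))"
    unfolding sum_distrib_left by (rule sum.swap)
  finally show ?thesis by (simp only: sym_sum_def V_def x_def)
qed

end
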